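(* Let $\mathbb{F}$ be a field of characteristic $p>2$, let $\chi\in\mathfrak{sl}(2)^*$ with $\chi(e)=0$, and let $\lambda\in\Lambda_\chi$. Then $$\mathrm{Der}(\mathfrak{sl}(2), L_{\chi}(\lambda))=\begin{cases}\mathrm{Ider}(\mathfrak{sl}(2), L_{\chi}(\lambda))+\mathbb{F}d_1+\mathbb{F}d_2, & (\chi,\lambda)=(0,p-2),\\ \mathrm{Ider}(\mathfrak{sl}(2), L_{\chi}(\lambda)), & \text{otherwise},\end{cases}$$ where $d_1$ and $d_2$ are the linear maps from $\mathfrak{sl}(2)$ to $L_{0}(p-2)$ such that $d_{1}(h)=d_{1}(f)=0$, $d_{1}(e)=v_{p-2}$, and $d_{2}(h)=d_{2}(e)=0$, $d_{2}(f)=v_{0}$.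
   Context: The underlying field $\mathbb{F}$ has characteristic $p>2$, and $\mathbb{F}_p\subseteq\mathbb{F}$ is its prime field. $\mathfrak{sl}(2)$ is the 3-dimensional simple Lie algebra over $\mathbb{F}$ of trace-zero $2\times 2$ matrices, with standard basis $h=\mathrm{diag}(1,-1)$, $e=E_{12}$, $f=E_{21}$. It is a restricted Lie algebra with $h^{[p]}=h$, $e^{[p]}=f^{[p]}=0$. Derivations: for a finite-dimensional Lie algebra $\mathfrak{g}$ and a finite-dimensional $\mathfrak{g}$-module $M$, a derivation of $\mathfrak{g}$ on $M$ is a linear map $\phi:\mathfrak{g}\to M$ with $\phi([x,y])=x\phi(y)-y\phi(x)$ for all $x,y\in\mathfrak{g}$; $\mathrm{Der}(\mathfrak{g},M)$ is the space of these. For $m\in M$ the inner derivation $D_m$ is $D_m(x)=xm$; $\mathrm{Ider}(\mathfrak{g},M)$ is the space of inner derivations. Modules: let $\chi\in\mathfrak{sl}(2)^*$ with $\chi(e)=0$. $U_\chi(\mathfrak{sl}(2))$ is the quotient of the universal enveloping algebra of $\mathfrak{sl}(2)$ by the two-sided ideal generated by all $x^p-x^{[p]}-\chi(x)^p$, $x\in\mathfrak{sl}(2)$; $U_\chi$ of a restricted subalgebra is defined likewise. Put $\Lambda_\chi=\{\lambda\in\mathbb{F}\mid \lambda^p-\lambda=\chi(h)^p\}$. For $\lambda\in\Lambda_\chi$, let $\mathbb{F}v$ be the 1-dimensional $U_\chi(\mathbb{F}h+\mathbb{F}e)$-module with $hv=\lambda v$, $ev=0$, and let $Z_\chi(\lambda)=U_\chi(\mathfrak{sl}(2))\otimes_{U_\chi(\mathbb{F}h+\mathbb{F}e)}\mathbb{F}v$,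 with basis $v_i=f^i\otimes v$, $0\le i\le p-1$. $L_\chi(\lambda)$ denotes the unique simple quotient of $Z_\chi(\lambda)$ (images of the $v_i$ are denoted by the same symbols). Explicitly: (1) If $\chi(h)\ne0$ or $\chi(f)\neq 0$, $L_\chi(\lambda)$ has basis $v_0,\dots,v_{p-1}$ with $ev_i=i(\lambda-i+1)v_{i-1}$, $hv_i=(\lambda-2i)v_i$, $fv_i=v_{i+1}$ for $i<p-1$, and $fv_{p-1}=\chi(f)^pv_0$. (2) If $\chi=0$ (so $\lambda\in\mathbb{F}_p$), let $\Phi(\lambda)\in\{0,1,\dots,p-1\}$ be the integer congruent to $\lambda$ mod $p$; $L_0(\lambda)$ has basis $v_0,\dots,v_{\Phi(\lambda)}$ with $ev_i=i(\lambda-i+1)v_{i-1}$, $hv_i=(\lambda-2i)v_i$, $fv_i=v_{i+1}$ for $i<\Phi(\lambda)$, and $fv_{\Phi(\lambda)}=0$. Integers such as $p-2$ are viewed in $\mathbb{F}_p\subseteq\mathbb{F}$ when used as values of $\lambda$. *)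

theory Defs
  imports "HOL-Analysis.Analysis" "HOL-Library.Poly_Mapping"
begin

section \<open>The restricted Lie algebra of trace-zero two by two matrices\<close>

typedef (overloaded) ('a::field) sl2 = "{A :: 'a^2^2. trace A = 0}"
  morphisms sl2_matrix Abs_sl2
  by (rule exI[of _ 0]) (simp add: trace_def)

setup_lifting type_definition_sl2

lemma sl2_eq_iff: "x = y \<longleftrightarrow> sl2_matrix x = sl2_matrix y"
  by (simp add: sl2_matrix_inject)

instantiation sl2 :: (field) ab_group_add
begin
lift_definition zero_sl2 :: "'a sl2" is 0
  by (simp add: trace_def)
lift_definition plus_sl2 :: "'a sl2 \<Rightarrow> 'a sl2 \<Rightarrow> 'a sl2" is "(+)"
  by (simp add: trace_add)
lift_definition minus_sl2 :: "'a sl2 \<Rightarrow> 'a sl2 \<Rightarrow> 'a sl2" is "(-)"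
  by (simp add: trace_sub)
lift_definition uminus_sl2 :: "'a sl2 \<Rightarrow> 'a sl2" is uminus
  by (simp add: trace_def sum_negf)
instance
  by intro_classes (transfer; simp add: algebra_simps)+
end

lift_definition sl2_scale :: "'a::field \<Rightarrow> 'a sl2 \<Rightarrow> 'a sl2" is "\<lambda>c A. \<chi> i j. c * A $ i $ j"
  by (simp add: trace_def flip: sum_distrib_left)

lift_definition sl2_bracket :: "'a::field sl2 \<Rightarrow> 'a sl2 \<Rightarrow> 'a sl2" is "\<lambda>A B. A ** B - B ** A"
  by (simp only: trace_sub) (rule right_minus_eq[THEN iffD2, OF trace_mul_sym])

lift_definition sl2_h :: "'a::field sl2" is "vector [vector [1, 0], vector [0, -1]]"
  by (simp add: trace_def sum_2)
lift_definition sl2_e :: "'a::field sl2" is "vector [vector [0, 1], vector [0, 0]]"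
  by (simp add: trace_def sum_2)
lift_definition sl2_f :: "'a::field sl2" is "vector [vector [0, 0], vector [1, 0]]"
  by (simp add: trace_def sum_2)

lemma vector_space_sl2_scale: "vector_space (sl2_scale :: 'a::field \<Rightarrow> _)"
  by unfold_locales (transfer; simp add: vec_eq_iff algebra_simps)+

lemma sl2_basis_expansion:
  "x = sl2_scale (sl2_matrix x $ 1 $ 1) sl2_h + sl2_scale (sl2_matrix x $ 1 $ 2) sl2_e
     + sl2_scale (sl2_matrix x $ 2 $ 1) sl2_f"
proof transfer
  fix A :: "'a^2^2"
  assume "trace A = 0"
  then have "A $ 2 $ 2 = - A $ 1 $ 1"
    by (simp add: trace_def sum_2 eq_neg_iff_add_eq_0 add.commute[of "A $ 2 $ 2"])
  then show "A = (\<chi> i j. A $ 1 $ 1 * vector [vector [1, 0], vector [0, - 1]] $ i $ j)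
      + (\<chi> i j. A $ 1 $ 2 * vector [vector [0, 1], vector [0, 0]] $ i $ j)
      + (\<chi> i j. A $ 2 $ 1 * vector [vector [0, 0], vector [1, 0]] $ i $ j)"
    by (simp add: vec_eq_iff forall_2)
qed

lemma sl2_bracket_basis:
  "sl2_bracket sl2_h sl2_e = sl2_scale (2::'a::field) sl2_e"
  "sl2_bracket sl2_h sl2_f = sl2_scale (-2::'a::field) sl2_f"
  "sl2_bracket sl2_e sl2_f = (sl2_h :: 'a::field sl2)"
  by (transfer; simp add: vec_eq_iff forall_2 matrix_matrix_mult_def sum_2)+

definition matrix_power :: "'a::semiring_1^'n^'n \<Rightarrow> nat \<Rightarrow> 'a^'n^'n" where
  "matrix_power A n = (((**) A) ^^ n) (mat 1)"

(* The p-th power of a trace-zero matrix has trace zero when p > 2 (lemma below), so under that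
   hypothesis Abs_sl2 is applied inside its domain. *)
definition sl2_pmap :: "'a::field sl2 \<Rightarrow> 'a sl2" where
  "sl2_pmap x = Abs_sl2 (matrix_power (sl2_matrix x) CHAR('a))"

lemma sl2_matrix_square:
  "sl2_matrix x ** sl2_matrix (x :: 'a::field sl2) = mat (- det (sl2_matrix x))"
proof -
  have "trace (sl2_matrix x) = 0"
    using sl2_matrix[of x] by simp
  then have "sl2_matrix x $ 2 $ 2 = - sl2_matrix x $ 1 $ 1"
    by (simp add: trace_def sum_2 eq_neg_iff_add_eq_0 add.commute[of "sl2_matrix x $ 2 $ 2"])
  then show ?thesis
    by (simp add: vec_eq_iff forall_2 matrix_matrix_mult_def sum_2 mat_def det_2)
qed

lemma matrix_power_odd_sl2:
  "matrix_power (sl2_matrix x) (2 * k + 1)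
     = sl2_matrix (sl2_scale ((- det (sl2_matrix x)) ^ k) (x :: 'a::field sl2))"
proof (induction k)
  case 0
  show ?case
    by (simp add: matrix_power_def sl2_scale.rep_eq)
next
  case (Suc k)
  have "matrix_power (sl2_matrix x) (2 * Suc k + 1)
      = (sl2_matrix x ** sl2_matrix x) ** matrix_power (sl2_matrix x) (2 * k + 1)"
    by (simp add: matrix_power_def matrix_mul_assoc)
  also have "\<dots> = sl2_matrix (sl2_scale ((- det (sl2_matrix x)) ^ Suc k) x)"
    unfolding Suc sl2_matrix_square
    by (simp add: vec_eq_iff forall_2 matrix_matrix_mult_def sum_2 mat_def sl2_scale.rep_eq
        algebra_simps)
  finally show ?case .
qed

lemma odd_CHAR: "CHAR('a::field) > 2 \<Longrightarrow> odd CHAR('a)"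
  using prime_CHAR_semidom[where 'a = 'a] primes_dvd_imp_eq[of 2 "CHAR('a)"] two_is_prime_nat
  by fastforce

lemma sl2_pmap_eq:
  fixes x :: "'a::field sl2"
  assumes "CHAR('a) > 2"
  shows "sl2_pmap x = sl2_scale ((- det (sl2_matrix x)) ^ (CHAR('a) div 2)) x"
    and "sl2_matrix (sl2_pmap x) = matrix_power (sl2_matrix x) CHAR('a)"
proof -
  have *: "matrix_power (sl2_matrix x) CHAR('a)
      = sl2_matrix (sl2_scale ((- det (sl2_matrix x)) ^ (CHAR('a) div 2)) x)"
    using matrix_power_odd_sl2[of x "CHAR('a) div 2"] odd_CHAR[OF assms] by simp
  show "sl2_pmap x = sl2_scale ((- det (sl2_matrix x)) ^ (CHAR('a) div 2)) x"
    unfolding sl2_pmap_def * by (rule sl2_matrix_inverse)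
  with * show "sl2_matrix (sl2_pmap x) = matrix_power (sl2_matrix x) CHAR('a)"
    by simp
qed

lemma sl2_pmap_basis:
  assumes "CHAR('a::field) > 2"
  shows "sl2_pmap (sl2_h :: 'a sl2) = sl2_h"
    and "sl2_pmap (sl2_e :: 'a sl2) = 0"
    and "sl2_pmap (sl2_f :: 'a sl2) = 0"
proof -
  have "CHAR('a) div 2 > 0" using assms by simp
  moreover have "det (sl2_matrix (sl2_h :: 'a sl2)) = -1"
    "det (sl2_matrix (sl2_e :: 'a sl2)) = 0" "det (sl2_matrix (sl2_f :: 'a sl2)) = 0"
    by (simp_all add: det_2 sl2_h.rep_eq sl2_e.rep_eq sl2_f.rep_eq)
  moreover have "sl2_scale 1 x = x" "sl2_scale 0 x = 0" for x :: "'a sl2"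
    by (transfer; simp add: vec_eq_iff)+
  ultimately show "sl2_pmap (sl2_h :: 'a sl2) = sl2_h"
    "sl2_pmap (sl2_e :: 'a sl2) = 0" "sl2_pmap (sl2_f :: 'a sl2) = 0"
    by (simp_all add: sl2_pmap_eq[OF assms] zero_power)
qed


section \<open>Ideals\<close>

definition left_ideal :: "'r::ring_1 set \<Rightarrow> bool" where
  "left_ideal N \<longleftrightarrow> 0 \<in> N \<and> (\<forall>a\<in>N. \<forall>b\<in>N. a + b \<in> N) \<and> (\<forall>u. \<forall>a\<in>N. u * a \<in> N)"

definition two_sided_ideal :: "'r::ring_1 set \<Rightarrow> bool" where
  "two_sided_ideal N \<longleftrightarrow> left_ideal N \<and> (\<forall>u. \<forall>a\<in>N. a * u \<in> N)"

lemma left_ideal_uminus: "left_ideal N \<Longrightarrow> a \<in> N \<Longrightarrow> - a \<in> N"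
  unfolding left_ideal_def by (metis mult_minus1)

lemma left_ideal_diff: "left_ideal N \<Longrightarrow> a \<in> N \<Longrightarrow> b \<in> N \<Longrightarrow> a - b \<in> N"
  using left_ideal_uminus[of N b] unfolding left_ideal_def
  by (metis ab_group_add_class.ab_diff_conv_add_uminus)

lemma left_ideal_hull: "left_ideal (left_ideal hull S)"
  unfolding left_ideal_def hull_def by blast

lemma two_sided_ideal_hull: "two_sided_ideal (two_sided_ideal hull S)"
  unfolding two_sided_ideal_def left_ideal_def hull_def by blast


section \<open>The universal enveloping algebra\<close>

datatype 'g word = Word (letters: "'g list")

(* The free monoid, written additively so that the finitely supported functions on it form the
   free associative algebra under the convolution product of Poly_Mapping. *)
instantiation word :: (type) monoid_add
begin
definition "0 = Word []"
definition "u + w = Word (letters u @ letters w)"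
instance
  by intro_classes (simp_all add: zero_word_def plus_word_def)
end

type_synonym 'a free_alg = "'a sl2 word \<Rightarrow>\<^sub>0 'a"

definition free_gen :: "'a::field sl2 \<Rightarrow> 'a free_alg" where
  "free_gen x = Poly_Mapping.single (Word [x]) 1"

definition free_const :: "'a::field \<Rightarrow> 'a free_alg" where
  "free_const c = Poly_Mapping.single 0 c"

(* Generators are indexed by all elements of the Lie algebra; the first two families of relations
   make the generator map linear, i.e. cut the free algebra down to the tensor algebra. *)
definition uea_ideal :: "'a::field free_alg set" where
  "uea_ideal = two_sided_ideal hull
     ({free_gen (x + y) - free_gen x - free_gen y | x y. True} \<union>
      {free_gen (sl2_scale c x) - free_const c * free_gen x | c x. True} \<union>
      {free_gen x * free_gen y - free_gen y * free_gen x - free_gen (sl2_bracket x y) | x y. True})"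

lemma left_ideal_uea_ideal: "left_ideal uea_ideal"
  and uea_ideal_mult_right: "a \<in> uea_ideal \<Longrightarrow> a * u \<in> uea_ideal"
  using two_sided_ideal_hull unfolding uea_ideal_def two_sided_ideal_def by blast+

lemma zero_in_uea_ideal: "0 \<in> uea_ideal"
  by (rule conjunct1[OF left_ideal_uea_ideal[unfolded left_ideal_def]])

lemma word_add_eq_0_iff: "u + w = (0 :: 'g word) \<longleftrightarrow> u = 0 \<and> w = 0"
  by (cases u; cases w) (simp add: zero_word_def plus_word_def)

lemma lookup_times_0:
  "Poly_Mapping.lookup (s * t :: 'g word \<Rightarrow>\<^sub>0 'b::semiring_0) 0
     = Poly_Mapping.lookup s 0 * Poly_Mapping.lookup t 0"
proof -
  have "Poly_Mapping.lookup (s * t) 0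
      = (\<Sum>l. Poly_Mapping.lookup s l * (\<Sum>q. Poly_Mapping.lookup t q when 0 = l + q))"
    by (simp add: lookup_mult)
  also have "\<dots> = (\<Sum>l. (Poly_Mapping.lookup s l * Poly_Mapping.lookup t 0) when l = 0)"
  proof (rule Sum_any.cong)
    fix l :: "'g word"
    have "(\<Sum>q. Poly_Mapping.lookup t q when 0 = l + q)
        = (\<Sum>q. (Poly_Mapping.lookup t q when l = 0) when q = 0)"
      by (rule Sum_any.cong) (auto simp: when_def word_add_eq_0_iff eq_commute[of 0])
    then show "Poly_Mapping.lookup s l * (\<Sum>q. Poly_Mapping.lookup t q when 0 = l + q)
        = (Poly_Mapping.lookup s l * Poly_Mapping.lookup t 0 when l = 0)"
      by (simp add: when_def)
  qed
  finally show ?thesis by simp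
qed

lemma uea_ideal_proper: "1 \<notin> (uea_ideal :: 'a::field free_alg set)"
proof -
  let ?A = "{t :: 'a free_alg. Poly_Mapping.lookup t 0 = 0}"
  have "two_sided_ideal ?A"
    by (simp add: two_sided_ideal_def left_ideal_def lookup_add lookup_times_0)
  moreover have gen: "Poly_Mapping.lookup (free_gen x) 0 = 0" for x :: "'a sl2"
    by (simp add: free_gen_def zero_word_def lookup_single)
  ultimately have "uea_ideal \<subseteq> ?A"
    unfolding uea_ideal_def
    by (intro hull_minimal) (auto simp: lookup_minus lookup_times_0 gen)
  moreover have "1 \<notin> ?A"
    by simp
  ultimately show ?thesis
    by blast
qed

quotient_type (overloaded) 'a uea = "'a::field free_alg" / "\<lambda>s t. s - t \<in> uea_ideal"
proof (rule equivpI)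
  show "reflp (\<lambda>s t :: 'a free_alg. s - t \<in> uea_ideal)"
    using left_ideal_uea_ideal by (auto simp: reflp_def left_ideal_def)
  show "symp (\<lambda>s t :: 'a free_alg. s - t \<in> uea_ideal)"
    by (auto simp: symp_def dest: left_ideal_uminus[OF left_ideal_uea_ideal])
  show "transp (\<lambda>s t :: 'a free_alg. s - t \<in> uea_ideal)"
  proof (rule transpI)
    fix r s t :: "'a free_alg"
    assume "r - s \<in> uea_ideal" "s - t \<in> uea_ideal"
    then have "(r - s) + (s - t) \<in> uea_ideal"
      using left_ideal_uea_ideal unfolding left_ideal_def by blast
    then show "r - t \<in> uea_ideal" by simp
  qed
qed

instantiation uea :: (field) ring_1
begin
lift_definition zero_uea :: "'a uea" is 0 .
lift_definition one_uea :: "'a uea" is 1 .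
lift_definition plus_uea :: "'a uea \<Rightarrow> 'a uea \<Rightarrow> 'a uea" is "(+)"
proof -
  fix a b c d :: "'a free_alg"
  assume "a - b \<in> uea_ideal" "c - d \<in> uea_ideal"
  then have "(a - b) + (c - d) \<in> uea_ideal"
    using left_ideal_uea_ideal unfolding left_ideal_def by blast
  then show "(a + c) - (b + d) \<in> uea_ideal" by (simp add: algebra_simps)
qed
lift_definition uminus_uea :: "'a uea \<Rightarrow> 'a uea" is uminus
proof -
  fix a b :: "'a free_alg"
  assume "a - b \<in> uea_ideal"
  then show "- a - - b \<in> uea_ideal"
    using left_ideal_uminus[OF left_ideal_uea_ideal] by fastforce
qed
lift_definition minus_uea :: "'a uea \<Rightarrow> 'a uea \<Rightarrow> 'a uea" is "(-)"
proof -
  fix a b c d :: "'a free_alg"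
  assume "a - b \<in> uea_ideal" "c - d \<in> uea_ideal"
  then have "(a - b) - (c - d) \<in> uea_ideal"
    by (rule left_ideal_diff[OF left_ideal_uea_ideal])
  then show "(a - c) - (b - d) \<in> uea_ideal" by (simp add: algebra_simps)
qed
lift_definition times_uea :: "'a uea \<Rightarrow> 'a uea \<Rightarrow> 'a uea" is "(*)"
proof -
  fix a b c d :: "'a free_alg"
  assume "a - b \<in> uea_ideal" "c - d \<in> uea_ideal"
  then have "(a - b) * c + b * (c - d) \<in> uea_ideal"
    using left_ideal_uea_ideal uea_ideal_mult_right unfolding left_ideal_def by blast
  then show "a * c - b * d \<in> uea_ideal" by (simp add: algebra_simps)
qed
instance
proof
  show "(0 :: 'a uea) \<noteq> 1"
  proof transfer
    show "(0 :: 'a free_alg) - 1 \<notin> uea_ideal"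
      using uea_ideal_proper left_ideal_uminus[OF left_ideal_uea_ideal] by fastforce
  qed
qed (transfer; simp add: zero_in_uea_ideal algebra_simps)+
end

lift_definition uea_gen :: "'a::field sl2 \<Rightarrow> 'a uea" is free_gen .
lift_definition uea_const :: "'a::field \<Rightarrow> 'a uea" is free_const .

lemma uea_const_simps:
  "uea_const (a + b) = uea_const a + uea_const (b :: 'a::field)"
  "uea_const (a * b) = uea_const a * uea_const b"
  "uea_const (0 :: 'a) = 0" "uea_const (1 :: 'a) = 1"
  "uea_const a * u = u * uea_const a"
  subgoal by transfer (simp add: free_const_def single_add zero_in_uea_ideal)
  subgoal by transfer (simp add: free_const_def mult_single zero_in_uea_ideal)
  subgoal by transfer (simp add: free_const_def zero_in_uea_ideal)
  subgoal by transfer (simp add: free_const_def zero_in_uea_ideal)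
  subgoal
  proof transfer
    fix a :: 'a and u :: "'a free_alg"
    have "free_const a * u = u * free_const a"
    proof (induction u rule: update_induct)
      case const
      show ?case by simp
    next
      case (update g w b)
      then have "Poly_Mapping.update w b g = g + Poly_Mapping.single w b"
        by (intro poly_mapping_eqI) (auto simp: lookup_update lookup_add lookup_single in_keys_iff)
      with update show ?case
        by (simp add: free_const_def mult_single distrib_left distrib_right mult.commute)
    qed
    then show "free_const a * u - u * free_const a \<in> uea_ideal"
      by (simp add: zero_in_uea_ideal)
  qed
  done

lemma uea_gen_simps:
  "uea_gen (x + y) = uea_gen x + uea_gen y"
  "uea_gen (sl2_scale c x) = uea_const c * uea_gen x"
  "uea_gen (sl2_bracket x y) = uea_gen x * uea_gen y - uea_gen y * uea_gen x"
proof -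
  show "uea_gen (x + y) = uea_gen x + uea_gen y"
    by transfer (simp add: diff_diff_eq[symmetric], unfold uea_ideal_def, rule hull_inc, blast)
  show "uea_gen (sl2_scale c x) = uea_const c * uea_gen x"
    by transfer (unfold uea_ideal_def, rule hull_inc, blast)
  have "uea_gen x * uea_gen y - uea_gen y * uea_gen x = uea_gen (sl2_bracket x y)"
    by transfer (unfold uea_ideal_def, rule hull_inc, blast)
  then show "uea_gen (sl2_bracket x y) = uea_gen x * uea_gen y - uea_gen y * uea_gen x" ..
qed


section \<open>Modules, derivations and inner derivations\<close>

record (overloaded) ('a::field, 'm) sl2_module =
  mcarrier :: "'m set"
  mzero :: 'm
  madd :: "'m \<Rightarrow> 'm \<Rightarrow> 'm"
  mscale :: "'a \<Rightarrow> 'm \<Rightarrow> 'm"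
  mact :: "'a sl2 \<Rightarrow> 'm \<Rightarrow> 'm"

definition mdiff :: "('a::field, 'm) sl2_module \<Rightarrow> 'm \<Rightarrow> 'm \<Rightarrow> 'm" where
  "mdiff M a b = madd M a (mscale M (-1) b)"

definition linear_into :: "('a::field, 'm) sl2_module \<Rightarrow> ('a sl2 \<Rightarrow> 'm) \<Rightarrow> bool" where
  "linear_into M \<phi> \<longleftrightarrow> (\<forall>x. \<phi> x \<in> mcarrier M) \<and>
     (\<forall>x y. \<phi> (x + y) = madd M (\<phi> x) (\<phi> y)) \<and>
     (\<forall>c x. \<phi> (sl2_scale c x) = mscale M c (\<phi> x))"

definition Der :: "('a::field, 'm) sl2_module \<Rightarrow> ('a sl2 \<Rightarrow> 'm) set" where
  "Der M = {\<phi>. linear_into M \<phi> \<and>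
     (\<forall>x y. \<phi> (sl2_bracket x y) = mdiff M (mact M x (\<phi> y)) (mact M y (\<phi> x)))}"

definition Ider :: "('a::field, 'm) sl2_module \<Rightarrow> ('a sl2 \<Rightarrow> 'm) set" where
  "Ider M = {\<lambda>x. mact M x m | m. m \<in> mcarrier M}"


section \<open>Quotients of the regular module\<close>

definition coset :: "'r::ring_1 set \<Rightarrow> 'r \<Rightarrow> 'r set" where
  "coset N u = (\<lambda>n. u + n) ` N"

definition quotient_module :: "'a::field uea set \<Rightarrow> ('a, 'a uea set) sl2_module" where
  "quotient_module N = \<lparr>
     mcarrier = range (coset N),
     mzero = coset N 0,
     madd = (\<lambda>A B. \<Union>a\<in>A. \<Union>b\<in>B. coset N (a + b)),
     mscale = (\<lambda>c A. \<Union>a\<in>A. coset N (uea_const c * a)),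
     mact = (\<lambda>x A. \<Union>a\<in>A. coset N (uea_gen x * a))\<rparr>"

lemma coset_eq_iff:
  assumes "left_ideal N"
  shows "coset N u = coset N w \<longleftrightarrow> u - w \<in> N"
proof
  assume "coset N u = coset N w"
  moreover have "u \<in> coset N u"
    using assms by (force simp: coset_def left_ideal_def)
  ultimately show "u - w \<in> N"
    by (auto simp: coset_def)
next
  assume *: "u - w \<in> N"
  have "coset N u \<subseteq> coset N w" if "u - w \<in> N" for u w
  proof
    fix z assume "z \<in> coset N u"
    then obtain n where "n \<in> N" "z = u + n" by (auto simp: coset_def)
    then have "z = w + ((u - w) + n)" "(u - w) + n \<in> N"
      using that assms by (auto simp: left_ideal_def)
    then show "z \<in> coset N w" unfolding coset_def by (rule image_eqI)
  qed
  from this[OF *] this[of w u] left_ideal_uminus[OF assms *]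
  show "coset N u = coset N w" by simp
qed

lemma quotient_module_simps:
  assumes N: "left_ideal N"
  shows "madd (quotient_module N) (coset N u) (coset N w) = coset N (u + w)"
    and "mscale (quotient_module N) c (coset N u) = coset N (uea_const c * u)"
    and "mact (quotient_module N) x (coset N u) = coset N (uea_gen x * u)"
    and "mdiff (quotient_module N) (coset N u) (coset N w) = coset N (u - w)"
proof -
  have self: "u \<in> coset N u" for u
    using N by (force simp: coset_def left_ideal_def)
  have UN: "(\<Union>a\<in>coset N u. F a) = X" if "\<And>a. a \<in> coset N u \<Longrightarrow> F a = X" for F u and X :: "'a uea set"
    using that self[of u] by blast
  have mem: "a - u \<in> N" if "a \<in> coset N u" for a u
    using that by (auto simp: coset_def)
  have mult: "coset N (r * a) = coset N (r * u)" if "a \<in> coset N u" for r a u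
    using mem[OF that] N by (simp add: coset_eq_iff left_ideal_def flip: right_diff_distrib)
  have plus: "coset N (a + b) = coset N (u + w)" if "a \<in> coset N u" "b \<in> coset N w" for a b u w
  proof -
    have "(a - u) + (b - w) \<in> N"
      using mem[OF that(1)] mem[OF that(2)] N unfolding left_ideal_def by blast
    then show ?thesis
      by (simp add: coset_eq_iff[OF N] algebra_simps)
  qed
  have madd: "madd (quotient_module N) (coset N u) (coset N w) = coset N (u + w)" for u w
    unfolding quotient_module_def by (simp, intro UN plus)
  have mscale: "mscale (quotient_module N) c (coset N u) = coset N (uea_const c * u)" for c u
    unfolding quotient_module_def by (simp, intro UN mult)
  show "madd (quotient_module N) (coset N u) (coset N w) = coset N (u + w)"
    by (rule madd)
  show "mscale (quotient_module N) c (coset N u) = coset N (uea_const c * u)"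
    by (rule mscale)
  show "mact (quotient_module N) x (coset N u) = coset N (uea_gen x * u)"
    unfolding quotient_module_def by (simp, intro UN mult)
  have "uea_const (-1) = (-1 :: 'a uea)"
    using uea_const_simps(1)[of "-1 :: 'a" 1] uea_const_simps(3,4)[where 'a = 'a]
    by (simp add: eq_neg_iff_add_eq_0)
  then show "mdiff (quotient_module N) (coset N u) (coset N w) = coset N (u - w)"
    by (simp add: mdiff_def madd mscale)
qed


section \<open>Baby Verma modules and their simple quotients\<close>

(* The reduced enveloping algebra U_chi is the quotient of the enveloping algebra by this ideal. *)
definition reduced_ideal :: "('a::field sl2 \<Rightarrow> 'a) \<Rightarrow> 'a uea set" where
  "reduced_ideal chi = two_sided_ideal hull
     {uea_gen x ^ CHAR('a) - uea_gen (sl2_pmap x) - uea_const (chi x ^ CHAR('a)) | x. True}"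

definition Lambda :: "('a::field sl2 \<Rightarrow> 'a) \<Rightarrow> 'a set" where
  "Lambda chi = {lam. lam ^ CHAR('a) - lam = chi sl2_h ^ CHAR('a)}"

(* Let B = F h + F e and let F v be the one-dimensional module with h v = lam v, e v = 0.
   Over the base field, U_chi (x) F v is identified with U_chi via u (x) v |-> u.  The tensor
   product over U_chi(B) then imposes u b (x) v = u (x) b v, and it suffices to do so for the
   algebra generators b = a h + c e, which act on v by a * lam.  So the baby Verma module
   Z_chi(lam) is the enveloping algebra modulo the left ideal below, and v_i is the class
   of f ^ i. *)
definition verma_ideal :: "('a::field sl2 \<Rightarrow> 'a) \<Rightarrow> 'a \<Rightarrow> 'a uea set" where
  "verma_ideal chi lam = left_ideal hull
     (reduced_ideal chi \<union>
      {u * uea_gen (sl2_scale a sl2_h + sl2_scale c sl2_e) - uea_const (a * lam) * u | u a c. True})"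

(* Submodules of Z_chi(lam) correspond to the left ideals containing verma_ideal chi lam.  Since
   Z_chi(lam) is generated by its lam-weight space F v_0, the sum of all its proper submodules is
   proper, hence is the unique maximal submodule; simple_ideal is the corresponding left ideal. *)
definition simple_ideal :: "('a::field sl2 \<Rightarrow> 'a) \<Rightarrow> 'a \<Rightarrow> 'a uea set" where
  "simple_ideal chi lam = left_ideal hull
     (verma_ideal chi lam \<union> \<Union>{N. left_ideal N \<and> verma_ideal chi lam \<subseteq> N \<and> N \<noteq> UNIV})"

lemma proper_ideal_le_simple_ideal:
  "left_ideal N \<Longrightarrow> verma_ideal chi lam \<subseteq> N \<Longrightarrow> N \<noteq> UNIV \<Longrightarrow> N \<subseteq> simple_ideal chi lam"
  unfolding simple_ideal_def by (rule order_trans[OF _ hull_subset]) blast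

definition L :: "('a::field sl2 \<Rightarrow> 'a) \<Rightarrow> 'a \<Rightarrow> ('a, 'a uea set) sl2_module" where
  "L chi lam = quotient_module (simple_ideal chi lam)"

definition L_vec :: "('a::field sl2 \<Rightarrow> 'a) \<Rightarrow> 'a \<Rightarrow> nat \<Rightarrow> 'a uea set" where
  "L_vec chi lam i = coset (simple_ideal chi lam) (uea_gen sl2_f ^ i)"

end

theory Submission
  imports Defs "HOL-Library.Function_Algebras"
begin

text \<open>
  The map taking x to x^p - x^[p] in the enveloping algebra is additive and p-semilinear, so the
  relations of the reduced enveloping algebra need only be checked on h, e and f. The explicit
  module with basis v_0, ..., v_n is therefore a module over the reduced enveloping algebra, and a
  projection onto weight spaces shows that the annihilator of v_0 is the largest proper left ideal
  containing the ideal of the baby Verma module. Hence L is that explicit module.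

  A derivation is a triple (a, b, c) of values at h, e, f subject to three equations. If f acts
  invertibly, subtract the inner derivation that kills c; then a and b vanish. If h has no
  eigenvalue in the prime field, subtract the one that kills a; then b and c vanish. In the
  remaining restricted case, subtract inner derivations until a = 0; then b and c are multiples
  of v_n and v_0 that are killed by n + 2, so they survive exactly when n = p - 2.
\<close>

section \<open>Prime characteristic\<close>

text \<open>The reduced ideal contains a relation for every x, and in a noncommutative ring (x +
  y)^p has mixed terms. They are controlled by the quadratic form q = -det. Since x^2 = q(x) for
  trace-zero matrices, x^[p] = q(x)^((p-1)/2) x, and [x,[x,y]] is a combination of y and x with
  coefficients from q and its polar form. So the iterated commutators of x + t y have a closed form,
  and differentiating in t yields additivity.

  The simple quotient is pinned down from two sides: computation modulo the Verma ideal leaves only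
  the powers of f below p, and the explicit module shows which of them survive. One pair (kap, n)
  covers both shapes: (chi(f)^p, p - 1) for nonzero chi, and (0, Phi(lam)) for chi = 0.

  The number n + 2 is a comparison of weights. What remains at e is killed by f and must have weight
  2; what remains at f matters only modulo the image of f and must have weight -2. The vectors
  available are v_n and v_0, of weights -n and n.\<close>

lemma of_nat_power_char:
  assumes "prime CHAR('a::comm_semiring_1)"
  shows "of_nat k ^ CHAR('a) = (of_nat k :: 'a)"
proof (induction k)
  case 0
  then show ?case using prime_gt_0_nat[OF assms] by (simp add: zero_power)
next
  case (Suc k)
  then show ?case by (simp add: freshmans_dream[OF assms refl])
qed

lemma of_nat_inject_char:
  assumes "of_nat i = (of_nat j :: 'a::ring_1)" "i < CHAR('a)" "j < CHAR('a)"
  shows "i = j"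
  using assms
proof (induction i j rule: linorder_wlog)
  case (le i j)
  then have "of_nat (j - i) = (0 :: 'a)"
    by (simp add: of_nat_diff)
  then have "CHAR('a) dvd j - i"
    by (simp add: of_nat_eq_0_iff_char_dvd)
  then show ?case
    using le by (auto dest: dvd_imp_le)
qed simp

text \<open>The polynomial X^p - X has at most p roots, and the p distinct images of the naturals
  below p are already roots.\<close>

lemma frobenius_fixed_imp_of_nat:
  fixes x :: "'a::field"
  assumes "CHAR('a) > 2" "x ^ CHAR('a) = x"
  shows "\<exists>n<CHAR('a). x = of_nat n"
proof -
  let ?p = "CHAR('a)"
  have prime: "prime ?p"
    using assms(1) by (intro prime_CHAR_semidom) auto
  define P :: "'a poly" where "P = monom 1 ?p - monom 1 1"
  have "coeff P ?p = 1"
    using assms(1) by (simp add: P_def)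
  then have P: "P \<noteq> 0" by force
  have "degree P \<le> ?p"
    unfolding P_def using assms(1) by (intro degree_diff_le) (auto intro: order_trans[OF degree_monom_le])
  then have card: "card {y. poly P y = 0} \<le> ?p"
    using card_poly_roots_bound[OF P] by linarith
  have root: "poly P y = 0 \<longleftrightarrow> y ^ ?p = y" for y
    by (simp add: P_def poly_monom)
  have fin: "finite {y. poly P y = 0}"
    by (rule poly_roots_finite[OF P])
  have sub: "of_nat ` {..<?p} \<subseteq> {y. poly P y = 0}"
    by (auto simp: root of_nat_power_char[OF prime])
  have "inj_on (of_nat :: nat \<Rightarrow> 'a) {..<?p}"
    by (intro inj_onI of_nat_inject_char) auto
  then have "card (of_nat ` {..<?p} :: 'a set) = ?p"
    by (simp add: card_image)
  then have "of_nat ` {..<?p} = {y. poly P y = 0}"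
    using card_seteq[OF fin sub] card by simp
  then show ?thesis
    using assms(2) root by blast
qed

section \<open>Powers of sums in prime characteristic\<close>

definition commutator :: "'r::ring_1 \<Rightarrow> 'r \<Rightarrow> 'r" where
  "commutator x y = x * y - y * x"

text \<open>Neighbouring entries of row p - 1 of Pascal's triangle add up to an entry of row p
  divisible by p, so the row alternates in sign. The ring is arbitrary so that power series over the
  enveloping algebra are included.\<close>

lemma of_nat_choose_pred_prime:
  assumes "prime p" "of_nat p = (0 :: 'r::ring_1)" "k < p"
  shows "of_nat ((p - 1) choose k) = (- 1 :: 'r) ^ k"
  using assms(3)
proof (induction k)
  case (Suc k)
  have "p dvd p choose Suc k"
    using Suc.prems assms(1) by (intro dvd_choose_prime) auto
  then have "of_nat (p choose Suc k) = (0 :: 'r)"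
    using assms(2) by (auto elim!: dvdE)
  moreover have "p choose Suc k = ((p - 1) choose k) + ((p - 1) choose Suc k)"
    using Suc.prems by (cases p) auto
  ultimately show ?case
    using Suc by (simp add: add_eq_0_iff)
qed simp

text \<open>The commutator with \<open>z\<close> is left minus right multiplication by
  \<open>z\<close>. These two operators commute, so this is the binomial theorem.\<close>

lemma funpow_commutator_expand:
  "(commutator z ^^ n) y =
     (\<Sum>k\<le>n. of_int ((- 1) ^ (n + k) * int (n choose k)) * (z ^ k * y * z ^ (n - k)))"
proof (induction n)
  case (Suc n)
  define c where "c n k = (of_int ((- 1) ^ (n + k) * int (n choose k)) :: 'a)" for n k
  define P where "P k l = z ^ k * y * z ^ l" for k l
  have c0: "c (Suc n) 0 = - c n 0" and c_Suc: "c (Suc n) (Suc k) = c n k - c n (Suc k)"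
    and c_gt: "c n (Suc n) = 0" for k
    by (simp_all add: c_def algebra_simps binomial_eq_0)
  have zP: "z * (c n k * P k l) = c n k * P (Suc k) l" for k l
  proof -
    have "z * c n k = c n k * z"
      unfolding c_def by (rule mult_of_int_commute[symmetric])
    then show ?thesis
      by (simp add: P_def flip: mult.assoc)
  qed
  have Pz: "c n k * P k l * z = c n k * P k (Suc l)" for k l
    unfolding P_def by (simp only: power_Suc2 mult.assoc)
  have "(\<Sum>k\<le>Suc n. c (Suc n) k * P k (Suc n - k))
      = (\<Sum>k\<le>n. c n k * P (Suc k) (n - k)) - (c n 0 * P 0 (Suc n) + (\<Sum>k\<le>n. c n (Suc k) * P (Suc k) (n - k)))"
    unfolding sum.atMost_Suc_shift c0 c_Suc by (simp add: left_diff_distrib sum_subtractf)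
  also have "c n 0 * P 0 (Suc n) + (\<Sum>k\<le>n. c n (Suc k) * P (Suc k) (n - k))
      = (\<Sum>k\<le>Suc n. c n k * P k (Suc n - k))"
    unfolding sum.atMost_Suc_shift by simp
  also have "\<dots> = (\<Sum>k\<le>n. c n k * P k (Suc (n - k)))"
    by (simp add: c_gt Suc_diff_le)
  finally show ?case
    using Suc unfolding c_def[symmetric] P_def[symmetric]
    by (simp add: commutator_def sum_distrib_left sum_distrib_right zP Pz)
qed simp

text \<open>Modulo p the signs of the binomial expansion cancel those of the binomial coefficients.
  The left side is the derivative of z^p in the direction \<open>y\<close>, so this turns
  derivatives into commutators.\<close>

lemma sum_power_sandwich_prime:
  fixes z :: "'r::ring_1"
  assumes "prime p" "of_nat p = (0 :: 'r)" "odd p"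
  shows "(\<Sum>k<p. z ^ k * y * z ^ (p - 1 - k)) = (commutator z ^^ (p - 1)) y"
proof -
  have "of_int ((- 1) ^ (p - 1 + k) * int ((p - 1) choose k)) = (1 :: 'r)" if "k < p" for k
    using that assms(3) of_nat_choose_pred_prime[OF assms(1,2) that]
    by (cases "even k") simp_all
  moreover have "{..p - 1} = {..<p}"
    using assms(3) by (cases p) auto
  ultimately show ?thesis
    unfolding funpow_commutator_expand by (intro sum.cong) auto
qed

text \<open>Row p - 1 of Pascal's triangle sums to 2^(p-1); modulo p it becomes an alternating sum
  with an odd number of terms.\<close>

lemma two_power_pred_prime:
  assumes "prime p" "of_nat p = (0 :: 'r::ring_1)" "odd p"
  shows "(2 :: 'r) ^ (p - 1) = 1"
proof -
  have "(2::nat) ^ (p - 1) = (\<Sum>k\<le>p - 1. (p - 1) choose k)"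
    by (simp add: choose_row_sum)
  then have "(2 :: 'r) ^ (p - 1) = (\<Sum>k\<le>p - 1. of_nat ((p - 1) choose k))"
    by (metis of_nat_numeral of_nat_power of_nat_sum)
  also have "\<dots> = (\<Sum>k\<le>p - 1. (- 1) ^ k)"
  proof (rule sum.cong[OF refl])
    fix k assume "k \<in> {..p - 1}"
    then have "k < p" using assms(3) by (cases p) auto
    then show "of_nat ((p - 1) choose k) = (- 1 :: 'r) ^ k"
      by (rule of_nat_choose_pred_prime[OF assms(1,2)])
  qed
  also have "(\<Sum>k\<le>n. (- 1 :: 'r) ^ k) = (if even n then 1 else 0)" for n
    by (induction n) auto
  finally show ?thesis using assms(3) by simp
qed

section \<open>Polynomials in a central variable over a noncommutative ring\<close>

lemma fps_deriv_power_sandwich: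
  fixes z :: "'r::ring_1 fps"
  shows "fps_deriv (z ^ n) = (\<Sum>k<n. z ^ k * fps_deriv z * z ^ (n - 1 - k))"
proof (induction n)
  case (Suc n)
  have "fps_deriv (z ^ Suc n) = fps_deriv z * z ^ n + (\<Sum>k<n. z ^ Suc k * fps_deriv z * z ^ (n - 1 - k))"
    by (simp add: Suc sum_distrib_left mult.assoc add.commute)
  then show ?case
    by (simp add: sum.lessThan_Suc_shift del: sum.lessThan_Suc)
qed simp

lemma fps_central:
  fixes s t :: "'r::ring_1 fps"
  assumes "\<And>i u. fps_nth s i * u = u * fps_nth s i"
  shows "s * t = t * s"
proof (rule fps_ext)
  fix n
  have "(\<Sum>i=0..n. fps_nth s i * fps_nth t (n - i)) = (\<Sum>i=0..n. fps_nth s (n - i) * fps_nth t i)"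
    by (subst sum.atLeastAtMost_rev) (auto intro!: sum.cong)
  then show "fps_nth (s * t) n = fps_nth (t * s) n"
    by (simp add: fps_mult_nth assms)
qed

text \<open>A power series of degree at most \<open>n\<close>, recorded by three quantities that
  multiply when series are multiplied: its value \<open>a\<close> at 0, its coefficient
  \<open>c\<close> at t^n and its value \<open>r\<close> at 1.\<close>

definition fps_poly :: "nat \<Rightarrow> 'r::ring_1 fps \<Rightarrow> 'r \<Rightarrow> 'r \<Rightarrow> 'r \<Rightarrow> bool" where
  "fps_poly n s a c r \<longleftrightarrow> (\<forall>i>n. fps_nth s i = 0) \<and> fps_nth s 0 = a \<and> fps_nth s n = c \<and>
     (\<Sum>i\<le>n. fps_nth s i) = r"

lemma fps_poly_mult:
  assumes "fps_poly n s a c r" "fps_poly m t a' c' r'"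
  shows "fps_poly (n + m) (s * t) (a * a') (c * c') (r * r')"
proof -
  have s: "fps_nth s i = 0" if "i > n" for i
    using assms(1) that by (simp add: fps_poly_def)
  have t: "fps_nth t i = 0" if "i > m" for i
    using assms(2) that by (simp add: fps_poly_def)
  have "fps_nth (s * t) i = 0" if "i > n + m" for i
    unfolding fps_mult_nth
  proof (intro sum.neutral ballI)
    fix j
    show "fps_nth s j * fps_nth t (i - j) = 0"
      using that s[of j] t[of "i - j"] by (cases "j > n") auto
  qed
  moreover have "fps_nth (s * t) (n + m) = c * c'"
  proof -
    have "fps_nth (s * t) (n + m) = (\<Sum>i=0..n+m. if i = n then c * c' else 0)"
      unfolding fps_mult_nth
    proof (rule sum.cong[OF refl])
      fix i assume "i \<in> {0..n + m}"
      then show "fps_nth s i * fps_nth t (n + m - i) = (if i = n then c * c' else 0)"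
        using s[of i] t[of "n + m - i"] assms by (cases "i = n"; cases "i > n") (auto simp: fps_poly_def)
    qed
    then show ?thesis by simp
  qed
  moreover have "(\<Sum>k\<le>n+m. fps_nth (s * t) k) = r * r'"
  proof -
    have "(\<Sum>k\<le>n+m. fps_nth (s * t) k) = (\<Sum>k\<le>n+m. \<Sum>i\<le>k. fps_nth s i * fps_nth t (k - i))"
      by (simp add: fps_mult_nth atMost_atLeast0)
    also have "\<dots> = (\<Sum>(i, j)\<in>{(i, j). i + j \<le> n + m}. fps_nth s i * fps_nth t j)"
      by (rule sum.triangle_reindex_eq[symmetric])
    also have "\<dots> = (\<Sum>(i, j)\<in>{..n} \<times> {..m}. fps_nth s i * fps_nth t j)"
    proof (rule sum.mono_neutral_right)
      have "{(i, j). i + j \<le> n + m} \<subseteq> {..n + m} \<times> {..n + m}" by auto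
      then show "finite {(i, j). i + j \<le> n + m}"
        by (rule finite_subset) simp
      show "\<forall>x\<in>{(i, j). i + j \<le> n + m} - {..n} \<times> {..m}.
          (case x of (i, j) \<Rightarrow> fps_nth s i * fps_nth t j) = 0"
      proof
        fix x assume "x \<in> {(i, j). i + j \<le> n + m} - {..n} \<times> {..m}"
        then have "fst x > n \<or> snd x > m" by (cases x) auto
        then show "(case x of (i, j) \<Rightarrow> fps_nth s i * fps_nth t j) = 0"
          using s[of "fst x"] t[of "snd x"] by (auto simp: case_prod_unfold)
      qed
    qed auto
    also have "\<dots> = r * r'"
      using assms unfolding fps_poly_def sum.cartesian_product[symmetric] sum_product[symmetric]
      by simp
    finally show ?thesis .
  qed
  ultimately show ?thesis
    using assms by (simp add: fps_poly_def)
qed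

lemma fps_poly_power:
  assumes "fps_poly n s a c r"
  shows "fps_poly (k * n) (s ^ k) (a ^ k) (c ^ k) (r ^ k)"
proof (induction k)
  case 0
  show ?case by (simp add: fps_poly_def)
next
  case (Suc k)
  then show ?case using fps_poly_mult[OF assms] by simp
qed

lemma fps_poly_diff:
  assumes "fps_poly n s a c r" "fps_poly n t a' c' r'"
  shows "fps_poly n (s - t) (a - a') (c - c') (r - r')"
  using assms by (simp add: fps_poly_def sum_subtractf)

text \<open>For 0 < i < p the coefficient of t^i is killed by i, which is invertible by Bezout
  because p = 0. Only the coefficients at 1 and t^p are left.\<close>

lemma fps_poly_deriv_eq_0:
  fixes s :: "'r::ring_1 fps"
  assumes "fps_poly p s a c r" "fps_deriv s = 0" "prime p" "of_nat p = (0 :: 'r)"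
  shows "r = a + c"
proof -
  have "fps_nth s i = 0" if i: "0 < i" "i < p" for i
  proof -
    obtain j where j: "i = Suc j" using i(1) by (cases i) auto
    have 0: "of_nat i * fps_nth s i = 0"
      using assms(2) fps_deriv_nth[of s j] by (simp add: j)
    have "coprime i p"
      using prime_imp_coprime[OF assms(3), of i] i nat_dvd_not_less[of i p]
      by (simp add: coprime_commute)
    then obtain u v where "u * int i + v * int p = 1"
      using bezout_int[of "int i" "int p"] by auto
    then have "of_int (u * int i + v * int p) = (1 :: 'r)" by simp
    then have "of_int u * of_nat i = (1 :: 'r)" using assms(4) by simp
    moreover have "of_int u * of_nat i * fps_nth s i = 0"
      unfolding mult.assoc 0 by simp
    ultimately show ?thesis by simp
  qed
  then have "(\<Sum>i\<le>p. fps_nth s i) = (\<Sum>i\<in>{0, p}. fps_nth s i)"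
    by (intro sum.mono_neutral_right) auto
  then show ?thesis
    using assms(1) prime_gt_0_nat[OF assms(3)] by (auto simp: fps_poly_def)
qed

lemma mult_central:
  assumes "\<And>u. a * u = u * a" "\<And>u. b * u = u * b"
  shows "(a * b) * u = u * (a * b :: 'r::semigroup_mult)"
  by (metis assms mult.assoc)

lemma numeral_central: "numeral k * u = u * (numeral k :: 'r::semiring_1)"
  by (metis mult_of_nat_commute of_nat_numeral)

lemma commutator_central: "(\<And>u. c * u = u * c) \<Longrightarrow> commutator z (c * y) = c * commutator z y"
  unfolding commutator_def by (metis mult.assoc right_diff_distrib)

text \<open>The commutator with \<open>z\<close> kills \<open>2 * B * z\<close>, so
  \<open>4 * Q * y - 2 * B * z\<close> is an eigenvector of the squared commutator with central
  eigenvalue \<open>4 * Q\<close>.\<close>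

lemma funpow_commutator_quadratic:
  assumes Q: "\<And>u. Q * u = u * Q" and B: "\<And>u. B * u = u * B"
    and cc: "commutator z (commutator z y) = 4 * Q * y - 2 * B * z"
  shows "(commutator z ^^ (2 * k + 2)) y = (4 * Q) ^ k * (4 * Q * y - 2 * B * z)"
proof -
  have Q44: "4 * Q * u = u * (4 * Q)" and B2: "2 * B * u = u * (2 * B)" for u
    by (rule mult_central numeral_central Q B)+
  have Q4: "(4 * Q) ^ k * u = u * (4 * Q) ^ k" for u k
    by (rule power_commuting_commutes) (rule Q44)
  have "commutator z (2 * B * z) = 0"
    using commutator_central[OF B2, of z z] by (simp add: commutator_def)
  then have 1: "commutator z (4 * Q * y - 2 * B * z) = 4 * Q * commutator z y"
    using commutator_central[OF Q4[of 1], of z y]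
    by (simp add: commutator_def algebra_simps)
  show ?thesis
  proof (induction k)
    case 0
    show ?case by (simp add: cc)
  next
    case (Suc k)
    have "(commutator z ^^ (2 * Suc k + 2)) y = commutator z (commutator z ((commutator z ^^ (2 * k + 2)) y))"
      by simp
    also have "\<dots> = (4 * Q) ^ k * commutator z (commutator z (4 * Q * y - 2 * B * z))"
      by (simp only: Suc commutator_central[OF Q4])
    also have "commutator z (commutator z (4 * Q * y - 2 * B * z)) = 4 * Q * (4 * Q * y - 2 * B * z)"
      unfolding 1 commutator_central[OF Q44] cc ..
    also have "(4 * Q) ^ k * \<dots> = (4 * Q) ^ Suc k * (4 * Q * y - 2 * B * z)"
      by (simp only: power_Suc2 mult.assoc)
    finally show ?case .
  qed
qed

(* With z = x + t y and Q = q0 + b t + q1 t^2, the polynomial z^p - Q^m z in t has degree at most p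
   and derivative 0, so only its coefficients at 1 and t^p survive; now put t = 1. *)
lemma power_char_minus_additive:
  fixes x y :: "'r::ring_1"
  assumes p: "prime p" "of_nat p = (0 :: 'r)" "odd p"
    and central: "\<And>u. q0 * u = u * q0" "\<And>u. b * u = u * b" "\<And>u. q1 * u = u * q1"
    and xxy: "commutator x (commutator x y) = 4 * q0 * y - 2 * b * x"
    and yyx: "commutator y (commutator y x) = 4 * q1 * x - 2 * b * y"
  defines "m \<equiv> p div 2"
  shows "(x + y) ^ p - (q0 + b + q1) ^ m * (x + y) = (x ^ p - q0 ^ m * x) + (y ^ p - q1 ^ m * y)"
proof -
  let ?C = "fps_const" and ?X = "fps_X :: 'r fps"
  define z where "z = ?C x + ?X * ?C y"
  \<comment> \<open>If q0 and q1 are the values of a quadratic form at x and y, and b is its polar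
    value, then \<open>Q\<close> is its value at x + t y. \<open>B\<close> is the derivative of
    \<open>Q\<close> in t.\<close>
  define Q where "Q = ?C q0 + ?X * ?C b + ?X ^ 2 * ?C q1"
  define B where "B = ?C b + 2 * ?X * ?C q1"
  have two: "2 * u = u * (2 :: 'r)" for u
    by (metis mult_2 mult_2_right)
  have Q: "Q * u = u * Q" for u
    by (rule fps_central) (auto simp: Q_def fps_X_power_mult_nth central)
  have B: "B * u = u * B" for u
  proof (rule fps_central)
    fix i u
    have "B = ?C b + ?X * ?C (2 * q1)"
      unfolding B_def by (metis fps_const_mult fps_mult_fps_X_commute mult.assoc numeral_fps_const)
    moreover have "2 * q1 * u = u * (2 * q1)" for u
      by (metis central(3) mult.assoc two)
    ultimately show "fps_nth B i * u = u * fps_nth B i"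
      by (auto simp: central)
  qed
  have dz: "fps_deriv z = ?C y"
    by (simp add: z_def)
  have dQ: "fps_deriv Q = B"
    by (simp add: Q_def B_def power2_eq_square mult_2 distrib_right flip: mult.assoc)
  have m: "p = 2 * m + 1" "p - 1 = 2 * m" and "m > 0"
    using p(3) prime_gt_1_nat[OF p(1)] by (auto simp: m_def elim!: oddE)
  have CX: "?C a * (?X * s) = ?X * (?C a * s)" "?C a * ?X = ?X * ?C a" for a s
    by (metis fps_mult_fps_X_commute mult.assoc)+
  have cz: "commutator z (?C w) = ?C (commutator x w) + ?X * ?C (commutator y w)" for w
    by (simp add: commutator_def z_def distrib_left distrib_right CX mult.assoc algebra_simps
      flip: fps_const_sub)
  have four: "?X * ?C (2 * w) + ?X * ?C (2 * w) = ?X * ?C (4 * w)" for w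
  proof -
    have "2 * w + 2 * w = 4 * w"
      by (simp flip: distrib_right)
    then show ?thesis
      by (simp only: distrib_left[symmetric] fps_const_add)
  qed
  have "commutator y (commutator x y) = - commutator y (commutator y x)"
    by (simp add: commutator_def algebra_simps)
  then have "commutator z (commutator z (?C y))
      = ?C (4 * q0 * y - 2 * b * x) + ?X * ?C (2 * b * y - 4 * q1 * x)"
    using yyx xxy by (simp only: cz, simp add: commutator_def[of y y] cz)
  also have "\<dots> = 4 * Q * ?C y - 2 * B * z"
    by (simp add: four Q_def B_def z_def numeral_fps_const distrib_left distrib_right CX mult.assoc
        power2_eq_square algebra_simps flip: fps_const_sub)
  finally have cc: "commutator z (commutator z (?C y)) = 4 * Q * ?C y - 2 * B * z" .
  have p': "of_nat p = (0 :: 'r fps)"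
    using p(2) by (simp add: fps_of_nat[symmetric])
  have dzp: "fps_deriv (z ^ p) = (4 * Q) ^ (m - 1) * (4 * Q * ?C y - 2 * B * z)"
  proof -
    have "fps_deriv (z ^ p) = (commutator z ^^ (p - 1)) (?C y)"
      unfolding fps_deriv_power_sandwich dz by (rule sum_power_sandwich_prime[OF p(1) p' p(3)])
    also have "p - 1 = 2 * (m - 1) + 2"
      using m \<open>m > 0\<close> by simp
    finally show ?thesis
      by (simp only: funpow_commutator_quadratic[OF Q B cc])
  qed
  have dQm: "fps_deriv (Q ^ m) = of_nat m * Q ^ (m - 1) * B"
  proof -
    have "Q ^ k * B * Q ^ (m - 1 - k) = Q ^ (m - 1) * B" if "k < m" for k
    proof -
      have "Q ^ k * B * Q ^ (m - 1 - k) = Q ^ (k + (m - 1 - k)) * B"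
        by (simp only: mult.assoc B[of "Q ^ (m - 1 - k)"] power_add)
      then show ?thesis using that by simp
    qed
    then show ?thesis
      by (simp add: fps_deriv_power_sandwich dQ mult.assoc)
  qed
  have "4 ^ k * Q ^ k = (4 * Q) ^ k" for k
  proof (induction k)
    case (Suc k)
    then show ?case
      by (metis (no_types, opaque_lifting) Q mult.assoc power_Suc)
  qed simp
  then have Q4: "(4 * Q) ^ k = of_nat (4 ^ k) * Q ^ k" for k
    by simp
  have 4: "of_nat (4 ^ m) = (1 :: 'r fps)"
    using two_power_pred_prime[OF p(1) p' p(3)] unfolding m(2) by (simp add: power_mult)
  \<comment> \<open>This is the multiple of \<open>Q ^ (m - 1) * B * z\<close> left over in the
    derivative below. It vanishes: 2 c = 4^m + 2 m = 1 + 2 m = p = 0, and m + 1 is an inverse of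
    2.\<close>
  define c where "c = (of_nat (2 * 4 ^ (m - 1) + m) :: 'r fps)"
  have "c = 0"
  proof -
    have "2 * (2 * 4 ^ (m - 1) + m) = 4 ^ m + 2 * m"
      using \<open>m > 0\<close> by (cases m) auto
    then have "of_nat 2 * c = of_nat (4 ^ m) + of_nat (2 * m)"
      unfolding c_def by (metis of_nat_add of_nat_mult)
    also have "\<dots> = of_nat p"
      unfolding 4 by (simp add: m(1))
    finally have "of_nat (m + 1) * (of_nat 2 * c) = 0"
      using p' by simp
    moreover have "of_nat (m + 1) * of_nat 2 = (1 :: 'r fps)"
    proof -
      have "of_nat (m + 1) * of_nat 2 = of_nat p + (1 :: 'r fps)"
        unfolding m(1) by (simp add: algebra_simps)
      then show ?thesis by (simp only: p' add_0)
    qed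
    ultimately show ?thesis
      by (metis mult.assoc mult_1)
  qed
  \<comment> \<open>The two terms in \<open>Q ^ m * y\<close> cancel because 4^m = 1, and the terms
    in \<open>Q ^ (m - 1) * B * z\<close> collect to the factor \<open>c\<close>.\<close>
  have "fps_deriv (z ^ p - Q ^ m * z) = 0"
  proof -
    have "(4 * Q) ^ (m - 1) * (4 * Q * ?C y) = (4 * Q) ^ m * ?C y"
      using \<open>m > 0\<close> by (cases m) (simp_all add: power_Suc2 mult.assoc del: power_Suc)
    then have "(4 * Q) ^ (m - 1) * (4 * Q * ?C y) = Q ^ m * ?C y"
      by (simp add: Q4 4 del: of_nat_power)
    moreover have "(4 * Q) ^ (m - 1) * (2 * B * z) = of_nat (2 * 4 ^ (m - 1)) * Q ^ (m - 1) * B * z"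
    proof -
      have "Q ^ (m - 1) * (2 * B * z) = 2 * (Q ^ (m - 1) * B * z)"
        by (simp only: mult.assoc[symmetric] numeral_central[of _ "Q ^ (m - 1)"])
      moreover have "of_nat k * (2 * w) = of_nat (2 * k) * w" for k and w :: "'r fps"
        by (simp add: mult_2 distrib_left distrib_right)
      ultimately show ?thesis
        unfolding Q4 by (simp only: mult.assoc)
    qed
    ultimately have "fps_deriv (z ^ p - Q ^ m * z) = - (c * (Q ^ (m - 1) * B * z))"
      unfolding c_def of_nat_add by (simp add: dzp dQm dz right_diff_distrib distrib_right mult.assoc)
    then show ?thesis
      by (simp add: \<open>c = 0\<close>)
  qed
  moreover have "fps_poly p (z ^ p - Q ^ m * z) (x ^ p - q0 ^ m * x) (y ^ p - q1 ^ m * y)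
     ((x + y) ^ p - (q0 + b + q1) ^ m * (x + y))"
  proof -
    have z: "fps_poly 1 z x y (x + y)"
      by (auto simp: fps_poly_def z_def)
    have Q: "fps_poly 2 Q q0 q1 (q0 + b + q1)"
      by (auto simp: fps_poly_def Q_def fps_X_power_mult_nth numeral_2_eq_2)
    have "m * 2 + 1 = p" "p * 1 = p"
      by (simp_all add: m(1))
    then show ?thesis
      using fps_poly_diff[of p] fps_poly_power[OF z, of p] fps_poly_mult[OF fps_poly_power[OF Q, of m] z]
      by metis
  qed
  ultimately show ?thesis
    using fps_poly_deriv_eq_0[OF _ _ p(1,2)] by blast
qed

section \<open>The enveloping algebra and its representations\<close>

lemma uea_const_of_nat: "uea_const (of_nat n) = (of_nat n :: 'a::field uea)"
  by (induction n) (simp_all add: uea_const_simps)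

lemma uea_const_power: "uea_const (a ^ n) = uea_const a ^ n"
  by (induction n) (simp_all add: uea_const_simps)

lemma uea_const_numeral: "uea_const (numeral n) = (numeral n :: 'a::field uea)"
  using uea_const_of_nat[of "numeral n"] by simp

lemma uea_const_uminus: "uea_const (- a) = - uea_const (a :: 'a::field)"
  using uea_const_simps(1)[of "- a" a] by (simp add: uea_const_simps eq_neg_iff_add_eq_0)

lemma uea_const_diff: "uea_const (a - b) = uea_const a - uea_const (b :: 'a::field)"
  using uea_const_simps(1)[of a "- b"] by (simp add: uea_const_uminus)

lemma sl2_scale_linear:
  "sl2_scale (a + b) x = sl2_scale a x + sl2_scale b x"
  "sl2_scale a (x + y) = sl2_scale a x + sl2_scale a y"
  "sl2_scale a (sl2_scale b x) = sl2_scale (a * b) x"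
  "sl2_scale 0 x = 0" "sl2_scale 1 x = x" "sl2_scale a 0 = 0"
  by (transfer; simp add: vec_eq_iff algebra_simps)+

lemma uea_gen_0: "uea_gen (0 :: 'a::field sl2) = 0"
  using uea_gen_simps(1)[of "0 :: 'a sl2" 0] by simp

lemma uea_gen_uminus: "uea_gen (- x) = - uea_gen (x :: 'a::field sl2)"
  using uea_gen_simps(1)[of "- x" x] by (simp add: uea_gen_0 eq_neg_iff_add_eq_0)

lemma uea_gen_diff: "uea_gen (x - y) = uea_gen x - uea_gen (y :: 'a::field sl2)"
  using uea_gen_simps(1)[of x "- y"] by (simp add: uea_gen_uminus)

lemma commutator_uea_gen: "commutator (uea_gen x) (uea_gen y) = uea_gen (sl2_bracket x y)"
  by (simp add: commutator_def uea_gen_simps)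

text \<open>By Cayley-Hamilton this is the scalar x^2, which is why x^[p] is its power with exponent
  (p - 1)/2 times x.\<close>

definition sl2_quad :: "'a::field sl2 \<Rightarrow> 'a" where
  "sl2_quad x = - det (sl2_matrix x)"

definition sl2_polar :: "'a::field sl2 \<Rightarrow> 'a sl2 \<Rightarrow> 'a" where
  "sl2_polar x y = sl2_quad (x + y) - sl2_quad x - sl2_quad y"

lemma sl2_matrix_22: "sl2_matrix x $ 2 $ 2 = - sl2_matrix (x :: 'a::field sl2) $ 1 $ 1"
  using sl2_matrix[of x] by (simp add: trace_def sum_2 eq_neg_iff_add_eq_0 add.commute)

text \<open>As matrices, x^2 = q(x) and x y + y x is the polar value, so x y x is the polar value
  times x minus q(x) y. Insert this into x^2 y - 2 x y x + y x^2. The result feeds the hypotheses of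
  \<open>power_char_minus_additive\<close>.\<close>

lemma sl2_bracket_twice:
  "sl2_bracket x (sl2_bracket x y) =
     sl2_scale (4 * sl2_quad x) y - sl2_scale (2 * sl2_polar x y) (x :: 'a::field sl2)"
  unfolding sl2_eq_iff sl2_polar_def sl2_quad_def
  by (simp add: sl2_bracket.rep_eq minus_sl2.rep_eq plus_sl2.rep_eq sl2_scale.rep_eq vec_eq_iff
      forall_2 matrix_matrix_mult_def sum_2 det_2 sl2_matrix_22 algebra_simps)

lemma sl2_polar_commute: "sl2_polar x y = sl2_polar y x"
  by (simp add: sl2_polar_def add.commute)

text \<open>The relations of the reduced algebra set this element equal to the scalar
  \<open>chi x ^ p\<close>. The name refers to the p-centre of the enveloping algebra.\<close>

definition pcentral :: "'a::field sl2 \<Rightarrow> 'a uea" where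
  "pcentral x = uea_gen x ^ CHAR('a) - uea_gen (sl2_pmap x)"

lemma pcentral_add:
  fixes x y :: "'a::field sl2"
  assumes "CHAR('a) > 2"
  shows "pcentral (x + y) = pcentral x + pcentral y"
proof -
  let ?p = "CHAR('a)"
  have p: "prime ?p"
    using assms by (intro prime_CHAR_semidom) auto
  have p0: "of_nat ?p = (0 :: 'a uea)"
    using uea_const_of_nat[of ?p, where 'a = 'a] by (simp add: uea_const_simps)
  have cc: "commutator (uea_gen x) (commutator (uea_gen x) (uea_gen y))
     = 4 * uea_const (sl2_quad x) * uea_gen y - 2 * uea_const (sl2_polar x y) * uea_gen x" for x y :: "'a sl2"
    by (simp only: commutator_uea_gen sl2_bracket_twice uea_gen_diff uea_gen_simps(2)
        uea_const_simps(2) uea_const_numeral)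
  have pm: "uea_gen (sl2_pmap x) = uea_const (sl2_quad x) ^ (?p div 2) * uea_gen x" for x :: "'a sl2"
    by (simp add: sl2_pmap_eq[OF assms] sl2_quad_def uea_gen_simps uea_const_power)
  have "uea_const (sl2_quad (x + y)) = uea_const (sl2_quad x) + uea_const (sl2_polar x y) + uea_const (sl2_quad y)"
    by (simp add: sl2_polar_def flip: uea_const_simps)
  then show ?thesis
    using power_char_minus_additive[OF p p0 odd_CHAR[OF assms] uea_const_simps(5) uea_const_simps(5)
        uea_const_simps(5) cc[of x y] cc[of y x, unfolded sl2_polar_commute[of y x]]]
    by (simp only: pcentral_def pm uea_gen_simps)
qed

lemma sl2_quad_scale: "sl2_quad (sl2_scale c x) = c\<^sup>2 * sl2_quad x"
  by (simp add: sl2_quad_def sl2_scale.rep_eq det_2 algebra_simps power2_eq_square)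

text \<open>Constants are central and leave the p-th power as c^p. On the other side q is quadratic,
  so its power contributes c^(p-1), and x itself contributes the last factor c.\<close>

lemma pcentral_scale:
  fixes x :: "'a::field sl2"
  assumes "CHAR('a) > 2"
  shows "pcentral (sl2_scale c x) = uea_const (c ^ CHAR('a)) * pcentral x"
proof -
  have 1: "(uea_const c * u) ^ n = uea_const (c ^ n) * u ^ n" for u and n
  proof (induction n)
    case (Suc n)
    have "uea_const c * u * (uea_const (c ^ n) * u ^ n) = uea_const c * (u * uea_const (c ^ n)) * u ^ n"
      by (simp only: mult.assoc)
    also have "\<dots> = uea_const (c ^ Suc n) * u ^ Suc n"
      by (simp only: uea_const_simps(5)[of "c ^ n" u, symmetric] uea_const_simps(2) power_Suc mult.assoc)
    finally show ?case by (simp add: Suc)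
  qed (simp add: uea_const_simps)
  have "odd CHAR('a)" by (rule odd_CHAR[OF assms])
  then have "(c\<^sup>2) ^ (CHAR('a) div 2) * c = c ^ CHAR('a)"
    by (metis Suc_eq_plus1 odd_two_times_div_two_succ power_Suc2 power_mult)
  then have "(c\<^sup>2 * sl2_quad x) ^ (CHAR('a) div 2) * c = c ^ CHAR('a) * sl2_quad x ^ (CHAR('a) div 2)"
    by (simp add: power_mult_distrib flip: mult.assoc)
  then have "sl2_pmap (sl2_scale c x) = sl2_scale (c ^ CHAR('a)) (sl2_pmap x)"
    unfolding sl2_pmap_eq[OF assms] sl2_quad_def[symmetric] sl2_quad_scale sl2_scale_linear
    by simp
  then show ?thesis
    by (simp add: pcentral_def uea_gen_simps 1 right_diff_distrib)
qed

lemma poly_mapping_induct_add [case_names single add]: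
  fixes t :: "'b \<Rightarrow>\<^sub>0 'c::comm_monoid_add"
  assumes single: "\<And>w c. P (Poly_Mapping.single w c)"
    and add: "\<And>s t. P s \<Longrightarrow> P t \<Longrightarrow> P (s + t)"
  shows "P t"
proof (induction t rule: update_induct)
  case const
  show ?case using single[of _ 0] by simp
next
  case (update g w b)
  then have "Poly_Mapping.update w b g = g + Poly_Mapping.single w b"
    by (intro poly_mapping_eqI) (auto simp: lookup_update lookup_add lookup_single in_keys_iff)
  with update single add show ?case by simp
qed

text \<open>Words are built up from the left, the side on which the algebra acts on modules and left
  ideals.\<close>

lemma uea_induct [case_names const gen add]:
  fixes u :: "'a::field uea"
  assumes const: "\<And>c. P (uea_const c)"
    and gen: "\<And>x u. P u \<Longrightarrow> P (uea_gen x * u)"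
    and add: "\<And>u w. P u \<Longrightarrow> P w \<Longrightarrow> P (u + w)"
  shows "P u"
proof -
  obtain t where "u = abs_uea t"
    using Quotient3_abs_rep[OF Quotient3_uea, symmetric] by blast
  moreover have "P (abs_uea t)"
  proof (induction t rule: poly_mapping_induct_add)
    case (single w c)
    have "P (abs_uea (Poly_Mapping.single (Word xs) c))" for xs
    proof (induction xs)
      case Nil
      then show ?case
        using const[of c] by (simp add: uea_const.abs_eq free_const_def zero_word_def)
    next
      case (Cons x xs)
      have "Poly_Mapping.single (Word (x # xs)) c = free_gen x * Poly_Mapping.single (Word xs) c"
        by (simp add: free_gen_def mult_single plus_word_def)
      then show ?case
        using gen[OF Cons, of x] by (simp add: uea_gen.abs_eq times_uea.abs_eq)
    qed
    then show ?case by (cases w) simp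
  next
    case (add s t)
    then show ?case using assms(3) by (simp add: plus_uea.abs_eq[symmetric])
  qed
  ultimately show ?thesis by simp
qed

section \<open>Extending a representation to the enveloping algebra\<close>

locale sl2_representation = vector_space scale
  for scale :: "'a::field \<Rightarrow> 'v::ab_group_add \<Rightarrow> 'v" +
  fixes rho :: "'a sl2 \<Rightarrow> 'v \<Rightarrow> 'v"
  assumes rho_add: "rho (x + y) v = rho x v + rho y v"
    and rho_scale: "rho (sl2_scale c x) v = scale c (rho x v)"
    and rho_add_right: "rho x (v + w) = rho x v + rho x w"
    and rho_scale_right: "rho x (scale c v) = scale c (rho x v)"
    and rho_bracket: "rho (sl2_bracket x y) v = rho x (rho y v) - rho y (rho x v)"
begin

definition word_act :: "'a sl2 word \<Rightarrow> 'v \<Rightarrow> 'v" where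
  "word_act w v = foldr rho (letters w) v"

definition free_act :: "'a free_alg \<Rightarrow> 'v \<Rightarrow> 'v" where
  "free_act t v = (\<Sum>w\<in>Poly_Mapping.keys t. scale (Poly_Mapping.lookup t w) (word_act w v))"

definition uea_act :: "'a uea \<Rightarrow> 'v \<Rightarrow> 'v" where
  "uea_act u = free_act (rep_uea u)"

lemma word_act_plus: "word_act (u + w) v = word_act u (word_act w v)"
  by (simp add: word_act_def plus_word_def)

lemma word_act_linear:
  "word_act u (v + w) = word_act u v + word_act u w" "word_act u (scale c v) = scale c (word_act u v)"
proof -
  have "foldr rho us (v + w) = foldr rho us v + foldr rho us w"
    "foldr rho us (scale c v) = scale c (foldr rho us v)" for us
    by (induction us) (simp_all add: rho_add_right rho_scale_right)
  then show "word_act u (v + w) = word_act u v + word_act u w"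
    "word_act u (scale c v) = scale c (word_act u v)"
    by (simp_all add: word_act_def)
qed

lemma free_act_add: "free_act (s + t) v = free_act s v + free_act t v"
  unfolding free_act_def by (rule setsum_keys_plus_distrib) (simp_all add: scale_left_distrib)

lemma free_act_single: "free_act (Poly_Mapping.single w c) v = scale c (word_act w v)"
  by (simp add: free_act_def)

lemma free_act_linear:
  "free_act t (v + w) = free_act t v + free_act t w" "free_act t (scale c v) = scale c (free_act t v)"
  by (simp_all add: free_act_def word_act_linear scale_right_distrib sum.distrib scale_sum_right
      mult.commute)

lemma free_act_mult: "free_act (s * t) v = free_act s (free_act t v)"
proof (induction s rule: poly_mapping_induct_add)
  case (single u b)
  show ?case
  proof (induction t rule: poly_mapping_induct_add)
    case (single w c)
    then show ?case
      by (simp add: mult_single free_act_single word_act_plus word_act_linear)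
  next
    case (add s t)
    then show ?case
      by (simp add: distrib_left free_act_add free_act_linear)
  qed
next
  case (add s t)
  then show ?case
    by (simp add: distrib_right free_act_add)
qed

lemma free_act_0: "free_act 0 v = 0"
  by (simp add: free_act_def)

lemma free_act_0_right: "free_act t 0 = 0"
  using free_act_linear(2)[of t 0 0] by simp

lemma free_act_diff: "free_act (s - t) v = free_act s v - free_act t v"
  using free_act_add[of "s - t" t v] by simp

lemma free_act_gen: "free_act (free_gen x) v = rho x v"
  by (simp add: free_gen_def free_act_single word_act_def)

lemma free_act_const: "free_act (free_const c) v = scale c v"
  by (simp add: free_const_def free_act_single word_act_def zero_word_def)

text \<open>The elements acting by zero on every vector form a two-sided ideal, and the locale
  axioms place each defining relation in it. Hence \<open>uea_act\<close> does not depend on the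
  representative.\<close>

lemma free_act_uea_ideal:
  assumes "t \<in> uea_ideal"
  shows "free_act t v = 0"
proof -
  let ?A = "{t. \<forall>v. free_act t v = 0}"
  have "two_sided_ideal ?A"
    by (simp add: two_sided_ideal_def left_ideal_def free_act_add free_act_mult free_act_0
        free_act_0_right)
  then have "uea_ideal \<subseteq> ?A"
    unfolding uea_ideal_def
    by (intro hull_minimal)
      (auto simp: free_act_diff free_act_mult free_act_gen free_act_const rho_add rho_scale rho_bracket)
  with assms show ?thesis by blast
qed

lemma uea_act_abs: "uea_act (abs_uea t) v = free_act t v"
proof -
  have "rep_uea (abs_uea t) - t \<in> uea_ideal"
    using Quotient3_rep_abs[OF Quotient3_uea, of t] by (simp add: zero_in_uea_ideal)
  then show ?thesis
    using free_act_uea_ideal[of "rep_uea (abs_uea t) - t" v] by (simp add: uea_act_def free_act_diff)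
qed

lemma uea_act_simps:
  "uea_act (u + w) v = uea_act u v + uea_act w v"
  "uea_act (u - w) v = uea_act u v - uea_act w v"
  "uea_act (u * w) v = uea_act u (uea_act w v)"
  "uea_act 0 v = 0" "uea_act 1 v = v"
  "uea_act (uea_gen x) v = rho x v" "uea_act (uea_const c) v = scale c v"
  "uea_act u 0 = 0"
proof -
  obtain s t where st: "u = abs_uea s" "w = abs_uea t"
    using Quotient3_abs_rep[OF Quotient3_uea, symmetric] by blast
  show "uea_act (u + w) v = uea_act u v + uea_act w v"
    "uea_act (u - w) v = uea_act u v - uea_act w v"
    "uea_act (u * w) v = uea_act u (uea_act w v)"
    by (simp_all add: st plus_uea.abs_eq minus_uea.abs_eq times_uea.abs_eq uea_act_abs free_act_add
        free_act_diff free_act_mult)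
  show "uea_act 0 v = 0"
    by (simp add: zero_uea.abs_eq uea_act_abs free_act_0)
  show "uea_act 1 v = v"
    unfolding one_uea.abs_eq uea_act_abs single_one[symmetric] free_act_single
    by (simp add: word_act_def zero_word_def)
  show "uea_act (uea_gen x) v = rho x v" "uea_act (uea_const c) v = scale c v"
    by (simp_all add: uea_gen.abs_eq uea_const.abs_eq uea_act_abs free_act_gen free_act_const)
  show "uea_act u 0 = 0"
    by (simp add: st uea_act_abs free_act_0_right)
qed

lemma uea_act_linear:
  "uea_act u (v + w) = uea_act u v + uea_act u w" "uea_act u (scale c v) = scale c (uea_act u v)"
  by (simp_all add: uea_act_def free_act_linear)

lemma uea_act_power: "uea_act (u ^ k) v = (uea_act u ^^ k) v"
  by (induction k arbitrary: v) (simp_all add: uea_act_simps)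

end

section \<open>The explicit modules\<close>

(* Evaluating [e, f] = h and [h, f] = -2 f on the last basis vector v_n, with f v_n = kap v_0,
   forces (n + 1) (lam - n) = 0 and kap (n + 1) = 0. *)
locale sl2_string =
  fixes chi :: "'a::field sl2 \<Rightarrow> 'a" and lam kap :: 'a and n :: nat
  assumes char: "CHAR('a) > 2"
    and chi_linear: "Vector_Spaces.linear sl2_scale (*) chi"
    and chi_e: "chi sl2_e = 0"
    and lam: "lam \<in> Lambda chi"
    and kap: "kap = chi sl2_f ^ CHAR('a)"
    and n_less: "n < CHAR('a)"
    and top: "of_nat (n + 1) * (lam - of_nat n) = 0"
    and kap_top: "kap = 0 \<or> n + 1 = CHAR('a)"
begin

text \<open>A function \<open>w\<close> stands for the sum of the \<open>w i\<close> times v_i, so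
  the coefficient of e w at v_i comes from e v_(i+1). The three operators read and write only
  indices up to \<open>n\<close>, so the relations hold for every function and the whole type
  carries the representation.\<close>

definition opE :: "(nat \<Rightarrow> 'a) \<Rightarrow> nat \<Rightarrow> 'a" where
  "opE w i = (if i < n then of_nat (i + 1) * (lam - of_nat i) * w (i + 1) else 0)"

definition opH :: "(nat \<Rightarrow> 'a) \<Rightarrow> nat \<Rightarrow> 'a" where
  "opH w i = (if i \<le> n then (lam - 2 * of_nat i) * w i else 0)"

definition opF :: "(nat \<Rightarrow> 'a) \<Rightarrow> nat \<Rightarrow> 'a" where
  "opF w i = (if i \<le> n then if i = 0 then kap * w n else w (i - 1) else 0)"

definition scl :: "'a \<Rightarrow> (nat \<Rightarrow> 'a) \<Rightarrow> nat \<Rightarrow> 'a" where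
  "scl c w i = c * w i"

definition rho :: "'a sl2 \<Rightarrow> (nat \<Rightarrow> 'a) \<Rightarrow> nat \<Rightarrow> 'a" where
  "rho x w = scl (sl2_matrix x $ 1 $ 1) (opH w) + scl (sl2_matrix x $ 1 $ 2) (opE w)
     + scl (sl2_matrix x $ 2 $ 1) (opF w)"

definition W :: "(nat \<Rightarrow> 'a) set" where
  "W = {w. \<forall>i>n. w i = 0}"

definition \<delta> :: "nat \<Rightarrow> nat \<Rightarrow> 'a" where
  "\<delta> j i = (if i = j then 1 else 0)"

lemma scl_simps:
  "scl a (v + w) = scl a v + scl a w" "scl (a + b) v = scl a v + scl b v"
  "scl a (v - w) = scl a v - scl a w" "scl (a - b) v = scl a v - scl b v"
  "scl a (scl b v) = scl (a * b) v" "scl 1 v = v" "scl 0 v = 0" "scl a 0 = 0" "scl (- a) v = - scl a v"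
  by (simp_all add: scl_def fun_eq_iff algebra_simps)

lemma op_linear:
  "opE (v + w) = opE v + opE w" "opE (scl c w) = scl c (opE w)"
  "opH (v + w) = opH v + opH w" "opH (scl c w) = scl c (opH w)"
  "opF (v + w) = opF v + opF w" "opF (scl c w) = scl c (opF w)"
  by (auto simp: fun_eq_iff opE_def opH_def opF_def scl_def algebra_simps)

lemma op_relations:
  "opE (opF w) - opF (opE w) = opH w"
  "opH (opE w) - opE (opH w) = scl 2 (opE w)"
  "opH (opF w) - opF (opH w) = scl (- 2) (opF w)"
proof -
  have kn: "kap * (of_nat n + 1) = 0"
    using kap_top by (metis mult_eq_0_iff of_nat_1 of_nat_CHAR of_nat_add)
  show "opE (opF w) - opF (opE w) = opH w"
  proof
    fix i
    consider "i < n" "i = 0" | "i < n" "i > 0" | "i = n" "i = 0" | "i = n" "i > 0" | "i > n"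
      by linarith
    then show "(opE (opF w) - opF (opE w)) i = opH w i"
    proof cases
      case 4
      have "(of_nat (n + 1) * (lam - of_nat n)) * w n = 0"
        using top by simp
      with 4 show ?thesis
        by (simp add: opE_def opF_def opH_def of_nat_diff algebra_simps)
    next
      case 3
      with top show ?thesis
        unfolding opE_def opF_def opH_def fun_diff_def by simp
    qed (auto simp: opE_def opF_def opH_def of_nat_diff algebra_simps)
  qed
  show "opH (opE w) - opE (opH w) = scl 2 (opE w)"
    by (auto simp: fun_eq_iff opE_def opH_def scl_def algebra_simps)
  show "opH (opF w) - opF (opH w) = scl (- 2) (opF w)"
  proof
    fix i
    have "lam * (kap * w n) - kap * ((lam - 2 * of_nat n) * w n) + 2 * (kap * w n)
        = 2 * (kap * (of_nat n + 1)) * w n"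
      by (simp add: algebra_simps)
    also have "\<dots> = 0"
      using kn by simp
    finally show "(opH (opF w) - opF (opH w)) i = scl (- 2) (opF w) i"
      by (cases i) (auto simp: opF_def opH_def scl_def eq_neg_iff_add_eq_0 algebra_simps)
  qed
qed

lemma vector_space_scl: "vector_space scl"
  by unfold_locales (simp_all add: scl_simps)

sublocale sl2_representation scl rho
proof (intro sl2_representation.intro vector_space_scl sl2_representation_axioms.intro)
  fix x y :: "'a sl2" and v w c
  show "rho (x + y) v = rho x v + rho y v" "rho (sl2_scale c x) v = scl c (rho x v)"
    by (simp_all add: rho_def plus_sl2.rep_eq sl2_scale.rep_eq scl_simps algebra_simps)
  show "rho x (v + w) = rho x v + rho x w" "rho x (scl c v) = scl c (rho x v)"
    by (simp_all add: rho_def op_linear scl_simps algebra_simps)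
  let ?x = "sl2_matrix x" and ?y = "sl2_matrix y"
  have "rho (sl2_bracket x y) v =
      scl (?x $ 1 $ 2 * ?y $ 2 $ 1 - ?y $ 1 $ 2 * ?x $ 2 $ 1) (opE (opF v) - opF (opE v))
      + scl (?x $ 1 $ 1 * ?y $ 1 $ 2 - ?y $ 1 $ 1 * ?x $ 1 $ 2) (opH (opE v) - opE (opH v))
      + scl (?x $ 1 $ 1 * ?y $ 2 $ 1 - ?y $ 1 $ 1 * ?x $ 2 $ 1) (opH (opF v) - opF (opH v))"
    unfolding op_relations rho_def
    by (simp add: sl2_bracket.rep_eq matrix_matrix_mult_def sum_2 sl2_matrix_22 scl_simps)
      (simp add: scl_def fun_eq_iff algebra_simps)
  also have "\<dots> = rho x (rho y v) - rho y (rho x v)"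
    unfolding rho_def op_linear scl_simps by (simp add: scl_def fun_eq_iff algebra_simps)
  finally show "rho (sl2_bracket x y) v = rho x (rho y v) - rho y (rho x v)" .
qed

lemma W_closed:
  "v \<in> W \<Longrightarrow> w \<in> W \<Longrightarrow> v + w \<in> W" "w \<in> W \<Longrightarrow> scl c w \<in> W"
  "rho x w \<in> W" "opE w \<in> W" "opF w \<in> W" "opH w \<in> W"
  by (auto simp: W_def scl_def rho_def opE_def opF_def opH_def)

lemma uea_act_W: "w \<in> W \<Longrightarrow> uea_act u w \<in> W"
  by (induction u rule: uea_induct) (simp_all add: uea_act_simps W_closed)

lemma rho_basis:
  "rho sl2_h = opH" "rho sl2_e = opE" "rho sl2_f = opF"
  by (auto simp: rho_def sl2_h.rep_eq sl2_e.rep_eq sl2_f.rep_eq scl_def fun_eq_iff)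

lemma opE_power: "i + k > n \<Longrightarrow> w \<in> W \<Longrightarrow> (opE ^^ k) w i = 0"
  by (induction k arbitrary: i) (auto simp: W_def opE_def)

lemma opH_power: "w \<in> W \<Longrightarrow> (opH ^^ k) w i = (lam - 2 * of_nat i) ^ k * w i"
  by (induction k arbitrary: i) (auto simp: W_def opH_def)

text \<open>At most n + 1 shifts wrap around no more than once, so a single factor
  \<open>kap\<close> appears.\<close>

lemma opF_power:
  assumes "w \<in> W" "k \<le> n + 1"
  shows "(opF ^^ k) w i =
    (if i \<le> n then if k \<le> i then w (i - k) else kap * w (n + 1 + i - k) else 0)"
  using assms(2)
proof (induction k arbitrary: i)
  case 0
  then show ?case using assms(1) by (auto simp: W_def)
next
  case (Suc k)
  then show ?case
    by (cases i) (auto simp: opF_def)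
qed

lemma prime_char: "prime CHAR('a)"
  using char by (intro prime_CHAR_semidom) auto

lemma of_int_power_char: "of_int k ^ CHAR('a) = (of_int k :: 'a)"
  using of_nat_power_char[OF prime_char] odd_CHAR[OF char] by (cases k rule: int_cases2) simp_all

text \<open>Integers are fixed by the p-th power map, whereas here \<open>lam ^ p - lam\<close> is
  nonzero.\<close>

lemma lam_not_int: "chi sl2_h \<noteq> 0 \<Longrightarrow> lam \<noteq> of_int k"
  using lam by (auto simp: Lambda_def of_int_power_char)

text \<open>Either the string has length p, and p shifts make one full turn, or \<open>kap\<close>
  is 0 and n + 1 shifts already give 0.\<close>

lemma opF_power_char:
  assumes "w \<in> W"
  shows "(opF ^^ CHAR('a)) w = scl kap w"
proof (cases "n + 1 = CHAR('a)")
  case True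
  show ?thesis
    using assms True[symmetric] opF_power[OF assms, of "n + 1"]
    by (auto simp: fun_eq_iff W_def scl_def)
next
  case False
  then have "kap = 0" using kap_top by simp
  then have "(opF ^^ (n + 1)) w = 0"
    using opF_power[OF assms, of "n + 1"] by (auto simp: fun_eq_iff)
  moreover have "(opF ^^ k) 0 = 0" for k
    by (induction k) (auto simp: opF_def fun_eq_iff)
  moreover have "CHAR('a) = (CHAR('a) - (n + 1)) + (n + 1)"
    using n_less by simp
  ultimately show ?thesis
    using \<open>kap = 0\<close> by (metis comp_apply funpow_add scl_simps(7))
qed

lemma uea_act_pcentral:
  assumes "w \<in> W"
  shows "uea_act (pcentral x) w = scl (chi x ^ CHAR('a)) w"
proof -
  interpret chi: Vector_Spaces.linear sl2_scale "(*)" chi by (rule chi_linear)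
  have gens: "(\<lambda>v. uea_act (uea_gen y) v) = rho y" for y
    by (simp add: uea_act_simps)
  have e: "uea_act (pcentral sl2_e) w = 0"
    using opE_power[OF _ assms] n_less
    by (simp add: pcentral_def sl2_pmap_basis[OF char] uea_gen_0 uea_act_simps uea_act_power gens
        rho_basis fun_eq_iff)
  have f: "uea_act (pcentral sl2_f) w = scl kap w"
    by (simp add: pcentral_def sl2_pmap_basis[OF char] uea_gen_0 uea_act_simps uea_act_power gens
        rho_basis opF_power_char[OF assms])
  have h: "uea_act (pcentral sl2_h) w = scl (chi sl2_h ^ CHAR('a)) w"
  proof
    fix i
    \<comment> \<open>Integers are fixed by the p-th power map, so all weights
      \<open>lam - 2 * i\<close> satisfy the equation that defines
      \<open>Lambda chi\<close>.\<close>
    have "(lam - 2 * of_nat i) ^ CHAR('a) + of_nat (2 * i) ^ CHAR('a) = lam ^ CHAR('a)"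
      using freshmans_dream[OF prime_char refl, of "lam - 2 * of_nat i" "of_nat (2 * i)"] by simp
    then have "(lam - 2 * of_nat i) ^ CHAR('a) - (lam - 2 * of_nat i) = chi sl2_h ^ CHAR('a)"
      using lam unfolding of_nat_power_char[OF prime_char] Lambda_def by (simp add: algebra_simps)
    then show "uea_act (pcentral sl2_h) w i = scl (chi sl2_h ^ CHAR('a)) w i"
      using assms by (simp add: pcentral_def sl2_pmap_basis[OF char] uea_act_simps uea_act_power gens
        rho_basis opH_power opH_def scl_def flip: left_diff_distrib) (auto simp: W_def)
  qed
  let ?x = "sl2_matrix x"
  have "chi x = ?x $ 1 $ 1 * chi sl2_h + ?x $ 2 $ 1 * chi sl2_f"
    by (subst sl2_basis_expansion[of x]) (simp add: chi.add chi.scale chi_e)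
  then have "chi x ^ CHAR('a) = (?x $ 1 $ 1) ^ CHAR('a) * chi sl2_h ^ CHAR('a) + (?x $ 2 $ 1) ^ CHAR('a) * kap"
    by (simp add: kap freshmans_dream[OF prime_char refl] power_mult_distrib)
  moreover have "pcentral x = uea_const ((?x $ 1 $ 1) ^ CHAR('a)) * pcentral sl2_h
      + uea_const ((?x $ 1 $ 2) ^ CHAR('a)) * pcentral sl2_e
      + uea_const ((?x $ 2 $ 1) ^ CHAR('a)) * pcentral sl2_f"
    by (subst sl2_basis_expansion[of x]) (simp only: pcentral_add[OF char] pcentral_scale[OF char])
  ultimately show ?thesis
    by (simp add: uea_act_simps e f h scl_simps)
qed

text \<open>The elements killing all of \<open>W\<close> form a two-sided ideal because
  \<open>W\<close> is stable; the annihilator of one vector is in general only a left ideal.\<close>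

lemma reduced_ideal_act:
  assumes "u \<in> reduced_ideal chi" "w \<in> W"
  shows "uea_act u w = 0"
proof -
  let ?A = "{u. \<forall>w\<in>W. uea_act u w = 0}"
  have "two_sided_ideal ?A"
    by (simp add: two_sided_ideal_def left_ideal_def uea_act_simps uea_act_W)
  then have "reduced_ideal chi \<subseteq> ?A"
    unfolding reduced_ideal_def
    by (intro hull_minimal)
      (auto simp: uea_act_simps uea_act_pcentral simp flip: pcentral_def)
  with assms show ?thesis by blast
qed

lemma \<delta>_W: "j \<le> n \<Longrightarrow> \<delta> j \<in> W"
  by (simp add: W_def \<delta>_def)

section \<open>The annihilator of the highest weight vector\<close>

definition annihilator :: "'a uea set" where
  "annihilator = {u. uea_act u (\<delta> 0) = 0}"

lemma left_ideal_annihilator: "left_ideal annihilator"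
  by (simp add: left_ideal_def annihilator_def uea_act_simps)

lemma annihilator_proper: "1 \<notin> annihilator"
  by (auto simp: annihilator_def uea_act_simps \<delta>_def fun_eq_iff)

lemma verma_ideal_le_annihilator: "verma_ideal chi lam \<subseteq> annihilator"
proof -
  have "rho (sl2_scale a sl2_h + sl2_scale c sl2_e) (\<delta> 0) = scl (a * lam) (\<delta> 0)" for a c
    by (simp add: rho_add rho_scale rho_basis)
      (auto simp: fun_eq_iff scl_def opH_def opE_def \<delta>_def)
  then show ?thesis
    unfolding verma_ideal_def
    by (intro hull_minimal left_ideal_annihilator)
      (auto simp: annihilator_def uea_act_simps uea_act_linear reduced_ideal_act \<delta>_W)
qed

text \<open>The second range is nonempty only if n + 1 < p, and then \<open>kap_top\<close> forces
  \<open>kap = 0\<close>.\<close>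

lemma uea_act_f_power:
  "k \<le> n \<Longrightarrow> uea_act (uea_gen sl2_f ^ k) (\<delta> 0) = \<delta> k"
  "n < k \<Longrightarrow> k < CHAR('a) \<Longrightarrow> uea_act (uea_gen sl2_f ^ k) (\<delta> 0) = 0"
proof -
  have F: "uea_act (uea_gen sl2_f ^ k) (\<delta> 0) = (opF ^^ k) (\<delta> 0)" for k
  proof -
    have "uea_act (uea_gen sl2_f) = opF"
      by (simp add: uea_act_simps rho_basis fun_eq_iff)
    then show ?thesis by (simp add: uea_act_power)
  qed
  have W0: "\<delta> 0 \<in> W" by (rule \<delta>_W) simp
  show "uea_act (uea_gen sl2_f ^ k) (\<delta> 0) = \<delta> k" if "k \<le> n"
    unfolding F using that opF_power[OF W0, of k] by (auto simp: fun_eq_iff \<delta>_def)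
  show "uea_act (uea_gen sl2_f ^ k) (\<delta> 0) = 0" if "n < k" "k < CHAR('a)"
  proof -
    have "kap = 0" using kap_top that by auto
    then have "(opF ^^ (n + 1)) (\<delta> 0) = 0"
      using opF_power[OF W0, of "n + 1"] by (auto simp: fun_eq_iff)
    moreover have "(opF ^^ k) 0 = 0" for k
      by (induction k) (auto simp: opF_def fun_eq_iff)
    moreover have "k = (k - (n + 1)) + (n + 1)"
      using that by simp
    ultimately show ?thesis
      unfolding F by (metis comp_apply funpow_add)
  qed
qed

end

section \<open>The maximal left ideal\<close>

lemma left_idealD:
  assumes "left_ideal N"
  shows "0 \<in> N" "a \<in> N \<Longrightarrow> b \<in> N \<Longrightarrow> a + b \<in> N" "a \<in> N \<Longrightarrow> u * a \<in> N"
    "a \<in> N \<Longrightarrow> b \<in> N \<Longrightarrow> a - b \<in> N"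
  using assms left_ideal_diff[OF assms] unfolding left_ideal_def by blast+

lemma left_ideal_sum: "left_ideal N \<Longrightarrow> (\<And>i. i \<in> A \<Longrightarrow> g i \<in> N) \<Longrightarrow> sum g A \<in> N"
  by (induction A rule: infinite_finite_induct) (auto intro: left_idealD)

lemma left_ideal_cong: "left_ideal N \<Longrightarrow> u - w \<in> N \<Longrightarrow> u \<in> N \<longleftrightarrow> w \<in> N"
  using left_idealD(2)[of N "u - w" w] left_idealD(4)[of N u "u - w"] by auto

lemma left_ideal_trans: "left_ideal N \<Longrightarrow> u - v \<in> N \<Longrightarrow> v - w \<in> N \<Longrightarrow> u - w \<in> N"
  using left_idealD(2)[of N "u - v" "v - w"] by simp

lemma left_ideal_eq_UNIV: "left_ideal N \<Longrightarrow> 1 \<in> N \<Longrightarrow> N = UNIV"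
  using left_idealD(3)[of N 1] by fastforce

lemma left_ideal_const_cancel:
  assumes "left_ideal N" "uea_const c * u \<in> N" "c \<noteq> 0"
  shows "u \<in> N"
proof -
  have "uea_const (inverse c) * (uea_const c * u) = u"
    using assms(3) unfolding mult.assoc[symmetric] uea_const_simps(2)[symmetric]
    by (simp add: uea_const_simps)
  then show ?thesis
    using left_idealD(3)[OF assms(1,2), of "uea_const (inverse c)"] by simp
qed

context sl2_string
begin

abbreviation "V \<equiv> verma_ideal chi lam"
abbreviation "Ue \<equiv> uea_gen (sl2_e :: 'a sl2)"
abbreviation "Uf \<equiv> uea_gen (sl2_f :: 'a sl2)"
abbreviation "Uh \<equiv> uea_gen (sl2_h :: 'a sl2)"

lemma left_ideal_V: "left_ideal V"
  unfolding verma_ideal_def by (rule left_ideal_hull)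

lemma verma_h: "Uh * Uf ^ k - uea_const (lam - 2 * of_nat k) * Uf ^ k \<in> V"
proof (induction k)
  case 0
  have "1 * uea_gen (sl2_scale 1 sl2_h + sl2_scale 0 sl2_e) - uea_const (1 * lam) * 1 \<in> V"
    unfolding verma_ideal_def by (rule hull_inc) blast
  then show ?case by (simp add: sl2_scale_linear)
next
  case (Suc k)
  have "Uh * Uf = Uf * Uh - uea_const 2 * Uf"
    using uea_gen_simps(3)[of "sl2_h :: 'a sl2" sl2_f]
    unfolding sl2_bracket_basis uea_gen_simps(2) uea_const_uminus by (simp add: algebra_simps)
  then have "Uh * Uf ^ Suc k = Uf * (Uh * Uf ^ k) - uea_const 2 * Uf ^ Suc k"
    by (simp only: power_Suc mult.assoc[symmetric] left_diff_distrib)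
  moreover have "uea_const (lam - 2 * of_nat (Suc k)) * Uf ^ Suc k
      = Uf * (uea_const (lam - 2 * of_nat k) * Uf ^ k) - uea_const 2 * Uf ^ Suc k"
  proof -
    have "uea_const a * Uf ^ Suc k = Uf * (uea_const a * Uf ^ k)" for a
      by (simp only: power_Suc mult.assoc[symmetric] uea_const_simps(5)[of a Uf])
    moreover have "lam - 2 * of_nat (Suc k) = (lam - 2 * of_nat k) - 2"
      by (simp add: algebra_simps)
    ultimately show ?thesis
      by (simp only: uea_const_diff[of "lam - 2 * of_nat k" 2] left_diff_distrib)
  qed
  ultimately show ?case
    using left_idealD(3)[OF left_ideal_V Suc, of Uf] by (simp add: right_diff_distrib)
qed

text \<open>Moving e past one factor f costs an h, whose value is supplied by
  \<open>verma_h\<close>. For k = 0 the truncated exponent does no harm because the coefficient is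
  0.\<close>

lemma verma_e:
  "Ue * Uf ^ k - uea_const (of_nat k * (lam - of_nat k + 1)) * Uf ^ (k - 1) \<in> V"
proof (induction k)
  case 0
  have "1 * uea_gen (sl2_scale 0 sl2_h + sl2_scale 1 sl2_e) - uea_const (0 * lam) * 1 \<in> V"
    unfolding verma_ideal_def by (rule hull_inc) blast
  then show ?case by (simp add: sl2_scale_linear uea_const_simps)
next
  case (Suc k)
  have "Ue * Uf = Uf * Ue + Uh"
    using uea_gen_simps(3)[of "sl2_e :: 'a sl2" sl2_f] unfolding sl2_bracket_basis
    by (simp add: algebra_simps)
  then have 1: "Ue * Uf ^ Suc k = Uf * (Ue * Uf ^ k) + Uh * Uf ^ k"
    by (simp only: power_Suc mult.assoc[symmetric] distrib_right)
  have 2: "Uf * (uea_const (of_nat k * (lam - of_nat k + 1)) * Uf ^ (k - 1))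
      = uea_const (of_nat k * (lam - of_nat k + 1)) * Uf ^ k"
    by (cases k) (simp_all add: uea_const_simps(3) uea_const_simps(5)[of _ Uf] flip: mult.assoc)
  have "of_nat (Suc k) * (lam - of_nat (Suc k) + 1)
      = of_nat k * (lam - of_nat k + 1) + (lam - 2 * of_nat k)"
    by (simp add: algebra_simps)
  then have 3: "uea_const (of_nat (Suc k) * (lam - of_nat (Suc k) + 1)) * Uf ^ (Suc k - 1)
      = uea_const (of_nat k * (lam - of_nat k + 1)) * Uf ^ k + uea_const (lam - 2 * of_nat k) * Uf ^ k"
    by (simp only: uea_const_simps(1) distrib_right diff_Suc_1)
  show ?case
    using left_idealD(2)[OF left_ideal_V left_idealD(3)[OF left_ideal_V Suc, of Uf] verma_h[of k]]
    unfolding 1 3 right_diff_distrib 2 by (simp add: algebra_simps)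
qed

lemma verma_f_power_char: "Uf ^ CHAR('a) - uea_const kap \<in> V"
proof -
  have "Uf ^ CHAR('a) - uea_gen (sl2_pmap sl2_f) - uea_const (chi sl2_f ^ CHAR('a)) \<in> reduced_ideal chi"
    unfolding reduced_ideal_def by (rule hull_inc) blast
  then show ?thesis
    unfolding verma_ideal_def
    by (intro hull_inc) (simp add: sl2_pmap_basis[OF char] uea_gen_0 kap)
qed

text \<open>Modulo \<open>V\<close>, the span of the powers of f below p contains the constants and
  is stable under e, f and h; higher powers are lowered by p through f^p = kap.\<close>

lemma verma_span: "\<exists>c. u - (\<Sum>i<CHAR('a). uea_const (c i) * Uf ^ i) \<in> V"
proof -
  let ?s = "\<lambda>c. \<Sum>i<CHAR('a). uea_const (c i) * Uf ^ i"
  let ?S = "{u. \<exists>c. u - ?s c \<in> V}"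
  note V = left_idealD[OF left_ideal_V]
  have plus: "u + w \<in> ?S" if "u \<in> ?S" "w \<in> ?S" for u w
  proof -
    obtain c d where "u - ?s c \<in> V" "w - ?s d \<in> V" using \<open>u \<in> ?S\<close> \<open>w \<in> ?S\<close> by blast
    from V(2)[OF this] have "(u + w) - ?s (\<lambda>i. c i + d i) \<in> V"
      by (simp add: uea_const_simps distrib_right sum.distrib algebra_simps)
    then show ?thesis unfolding mem_Collect_eq by (intro exI)
  qed
  have smul: "uea_const a * u \<in> ?S" if u: "u \<in> ?S" for a u
  proof -
    obtain c where "u - ?s c \<in> V" using u by blast
    from V(3)[OF this, of "uea_const a"] have "uea_const a * u - ?s (\<lambda>i. a * c i) \<in> V"
      by (simp add: uea_const_simps(2) right_diff_distrib sum_distrib_left mult.assoc)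
    then show ?thesis unfolding mem_Collect_eq by (intro exI)
  qed
  have cong: "u \<in> ?S" if uw: "u - w \<in> V" "w \<in> ?S" for u w
  proof -
    obtain c where "w - ?s c \<in> V" using uw by blast
    from left_ideal_trans[OF left_ideal_V uw(1) this] show ?thesis by blast
  qed
  have zero: "0 \<in> ?S"
    using V(1) by (intro CollectI exI[of _ "\<lambda>_. 0"]) (simp add: uea_const_simps)
  have sum: "sum g A \<in> ?S" if "\<And>i. i \<in> A \<Longrightarrow> g i \<in> ?S" for g and A :: "nat set"
    using that by (induction A rule: infinite_finite_induct) (use zero plus in \<open>simp_all del: mem_Collect_eq\<close>)
  have power: "Uf ^ k \<in> ?S" for k
  proof (induction k rule: less_induct)
    case (less k)
    show ?case
    proof (cases "k < CHAR('a)")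
      case True
      have "?s (\<lambda>i. if i = k then 1 else 0) = (\<Sum>i<CHAR('a). if i = k then Uf ^ k else 0)"
        by (rule sum.cong) (auto simp: uea_const_simps)
      then have "?s (\<lambda>i. if i = k then 1 else 0) = Uf ^ k"
        using True by simp
      then show ?thesis
        using V(1) by (intro CollectI exI[of _ "\<lambda>i. if i = k then 1 else 0"]) simp
    next
      case False
      let ?j = "k - CHAR('a)"
      have "Uf ^ ?j * (Uf ^ CHAR('a) - uea_const kap) = Uf ^ k - uea_const kap * Uf ^ ?j"
        using False by (simp add: right_diff_distrib uea_const_simps(5) flip: power_add)
      then have "Uf ^ k - uea_const kap * Uf ^ ?j \<in> V"
        using V(3)[OF verma_f_power_char, of "Uf ^ ?j"] by simp
      then show ?thesis
        using cong smul less.IH[of ?j] False char by simp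
    qed
  qed
  \<comment> \<open>Constants are central, so stability under left multiplication by
    \<open>g\<close> need only be tested on powers of f.\<close>
  have gen: "g * u \<in> ?S" if u: "u \<in> ?S" and g: "\<And>k. g * Uf ^ k \<in> ?S" for g u
  proof -
    obtain c where "u - ?s c \<in> V" using u by blast
    from V(3)[OF this, of g] have "g * u - (\<Sum>i<CHAR('a). uea_const (c i) * (g * Uf ^ i)) \<in> V"
      by (simp only: right_diff_distrib sum_distrib_left mult.assoc[symmetric] uea_const_simps(5)[of _ g])
    then show ?thesis
      by (rule cong) (rule sum, rule smul, rule g)
  qed
  have e: "Ue * u \<in> ?S" if u: "u \<in> ?S" for u
    by (rule gen[OF u]) (rule cong[OF verma_e smul[OF power]])
  have h: "Uh * u \<in> ?S" if u: "u \<in> ?S" for u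
    by (rule gen[OF u]) (rule cong[OF verma_h smul[OF power]])
  have f: "Uf * u \<in> ?S" if u: "u \<in> ?S" for u
    by (rule gen[OF u]) (use power[of "Suc k" for k] in simp)
  have "u \<in> ?S"
  proof (induction u rule: uea_induct)
    case (const c)
    show ?case using smul[OF power[of 0], of c] by (simp only: power_0 mult_1_right)
  next
    case (gen x u)
    have "uea_gen x = uea_const (sl2_matrix x $ 1 $ 1) * Uh + uea_const (sl2_matrix x $ 1 $ 2) * Ue
        + uea_const (sl2_matrix x $ 2 $ 1) * Uf"
      by (subst sl2_basis_expansion[of x]) (simp only: uea_gen_simps)
    then have "uea_gen x * u = uea_const (sl2_matrix x $ 1 $ 1) * (Uh * u)
        + uea_const (sl2_matrix x $ 1 $ 2) * (Ue * u) + uea_const (sl2_matrix x $ 2 $ 1) * (Uf * u)"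
      by (simp add: distrib_right mult.assoc)
    then show ?case
      by (simp only: plus smul e[OF gen] h[OF gen] f[OF gen])
  next
    case (add u w)
    then show ?case by (rule plus)
  qed
  then show ?thesis by blast
qed

(* y is a product of factors h - (lam - 2 j); taking for A all indices below p but one makes it
   a multiple of the projection onto a weight space. *)
lemma verma_weight_projection:
  assumes "finite A"
  shows "\<exists>y. \<forall>k. y * Uf ^ k - uea_const (\<Prod>j\<in>A. 2 * (of_nat j - of_nat k)) * Uf ^ k \<in> V"
  using assms
proof (induction A rule: finite_induct)
  case empty
  show ?case
    using left_idealD(1)[OF left_ideal_V] by (intro exI[of _ 1]) (simp add: uea_const_simps)
next
  case (insert j A)
  let ?p = "\<lambda>k. \<Prod>j\<in>A. 2 * (of_nat j - of_nat k) :: 'a"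
  obtain y where y: "y * Uf ^ k - uea_const (?p k) * Uf ^ k \<in> V" for k
    using insert by blast
  let ?g = "Uh - uea_const (lam - 2 * of_nat j)"
  have "?g * y * Uf ^ k - uea_const (2 * (of_nat j - of_nat k) * ?p k) * Uf ^ k \<in> V" for k
  proof (rule left_ideal_trans[OF left_ideal_V])
    show "?g * y * Uf ^ k - ?g * (uea_const (?p k) * Uf ^ k) \<in> V"
      using left_idealD(3)[OF left_ideal_V y[of k], of ?g] by (simp add: algebra_simps)
    have "?g * (uea_const (?p k) * Uf ^ k) = uea_const (?p k) * (?g * Uf ^ k)"
      by (simp only: mult.assoc[symmetric] uea_const_simps(5)[of _ ?g])
    moreover have "2 * (of_nat j - of_nat k) * ?p k
        = ?p k * ((lam - 2 * of_nat k) - (lam - 2 * of_nat j))"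
      by (simp add: algebra_simps)
    ultimately have "?g * (uea_const (?p k) * Uf ^ k) - uea_const (2 * (of_nat j - of_nat k) * ?p k) * Uf ^ k
        = uea_const (?p k) * (Uh * Uf ^ k - uea_const (lam - 2 * of_nat k) * Uf ^ k)"
      by (simp only: uea_const_simps(2) uea_const_diff mult.assoc left_diff_distrib right_diff_distrib)
        (simp add: algebra_simps)
    then show "?g * (uea_const (?p k) * Uf ^ k) - uea_const (2 * (of_nat j - of_nat k) * ?p k) * Uf ^ k \<in> V"
      using left_idealD(3)[OF left_ideal_V verma_h] by metis
  qed
  then show ?case
    using insert.hyps by (intro exI[of _ "?g * y"]) simp
qed

end

text \<open>This is irreducibility: every v_i leads back to v_0, either around the cycle by f, or
  down by e because no coefficient i (lam - i + 1) with 0 < i \<le> n vanishes.\<close>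

locale simple_sl2_string = sl2_string +
  assumes raise: "kap \<noteq> 0 \<or> (\<forall>i. 0 < i \<longrightarrow> i \<le> n \<longrightarrow> lam - of_nat i + 1 \<noteq> 0)"
begin

lemma of_nat_nonzero: "0 < i \<Longrightarrow> i < CHAR('a) \<Longrightarrow> of_nat i \<noteq> (0 :: 'a)"
  using nat_dvd_not_less by (auto simp: of_nat_eq_0_iff_char_dvd)

lemma one_mem_if_f_power_mem:
  assumes J: "left_ideal J" "V \<subseteq> J" and mem: "Uf ^ i \<in> J" and i: "i \<le> n"
  shows "1 \<in> J"
proof (cases "kap = 0")
  case False
  have "Uf ^ (CHAR('a) - i) * Uf ^ i = Uf ^ CHAR('a)"
    using i n_less by (simp flip: power_add)
  then have "Uf ^ CHAR('a) \<in> J"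
    using left_idealD(3)[OF J(1) mem, of "Uf ^ (CHAR('a) - i)"] by simp
  then have "uea_const kap * 1 \<in> J"
    using verma_f_power_char J left_ideal_cong[OF J(1), of "Uf ^ CHAR('a)" "uea_const kap"] by auto
  then show ?thesis
    by (rule left_ideal_const_cancel[OF J(1) _ False])
next
  case True
  from mem i show ?thesis
  proof (induction i)
    case (Suc i)
    let ?c = "of_nat (Suc i) * (lam - of_nat (Suc i) + 1)"
    have "Ue * Uf ^ Suc i \<in> J"
      by (rule left_idealD(3)[OF J(1) Suc.prems(1)])
    moreover have "Ue * Uf ^ Suc i - uea_const ?c * Uf ^ i \<in> J"
      using verma_e[of "Suc i"] J(2) by (auto simp del: power_Suc)
    ultimately have "uea_const ?c * Uf ^ i \<in> J"
      using left_ideal_cong[OF J(1)] by blast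
    moreover have "?c \<noteq> 0"
      using True raise Suc.prems(2) n_less of_nat_nonzero[of "Suc i"] by fastforce
    ultimately have "Uf ^ i \<in> J"
      by (rule left_ideal_const_cancel[OF J(1)])
    then show ?case
      using Suc by simp
  qed simp
qed

text \<open>The weights \<open>lam - 2 * i\<close> for i < p are distinct, so every term of
  \<open>u\<close> can be isolated inside \<open>J\<close>. A nonzero term with i \<le> n would put
  1 into \<open>J\<close>; all other terms kill v_0.\<close>

lemma proper_ideal_le_annihilator:
  assumes J: "left_ideal J" "V \<subseteq> J" "J \<noteq> UNIV"
  shows "J \<subseteq> annihilator"
proof
  fix u assume u: "u \<in> J"
  let ?p = "CHAR('a)"
  obtain c where c: "u - (\<Sum>i<?p. uea_const (c i) * Uf ^ i) \<in> V"
    using verma_span by blast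
  then have sum: "(\<Sum>i<?p. uea_const (c i) * Uf ^ i) \<in> J"
    using left_ideal_cong[OF J(1)] J(2) u by blast
  have "uea_const (c i) * Uf ^ i \<in> annihilator" if i: "i < ?p" for i
  proof (cases "c i = 0 \<or> n < i")
    case True
    then show ?thesis
      using i by (auto simp: annihilator_def uea_act_simps uea_act_f_power scl_simps)
  next
    case False
    let ?q = "\<lambda>k. \<Prod>j\<in>{..<?p} - {i}. 2 * (of_nat j - of_nat k) :: 'a"
    obtain y where y: "y * Uf ^ k - uea_const (?q k) * Uf ^ k \<in> V" for k
      using verma_weight_projection[of "{..<?p} - {i}"] by blast
    have q: "?q k = 0" if "k < ?p" "k \<noteq> i" for k
      using that by (intro prod_zero) auto
    have "(\<Sum>k<?p. uea_const (c k) * (uea_const (?q k) * Uf ^ k))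
        = (\<Sum>k<?p. if k = i then uea_const (c i * ?q i) * Uf ^ i else 0)"
    proof (rule sum.cong[OF refl])
      fix k assume "k \<in> {..<?p}"
      then show "uea_const (c k) * (uea_const (?q k) * Uf ^ k)
          = (if k = i then uea_const (c i * ?q i) * Uf ^ i else 0)"
        by (cases "k = i") (simp_all only: q lessThan_iff uea_const_simps(2,3) mult.assoc mult_zero_left
            mult_zero_right if_True if_False simp_thms)
    qed
    also have "\<dots> = uea_const (c i * ?q i) * Uf ^ i"
      using i by simp
    finally have *: "(\<Sum>k<?p. uea_const (c k) * (uea_const (?q k) * Uf ^ k)) = uea_const (c i * ?q i) * Uf ^ i" .
    have yc: "y * (uea_const s * t) = uea_const s * (y * t)" for s t
      by (simp only: mult.assoc[symmetric] uea_const_simps(5)[of s y])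
    have "y * (\<Sum>k<?p. uea_const (c k) * Uf ^ k) - uea_const (c i * ?q i) * Uf ^ i
        = (\<Sum>k<?p. uea_const (c k) * (y * Uf ^ k - uea_const (?q k) * Uf ^ k))"
      by (simp only: right_diff_distrib[of "uea_const s" for s] sum_subtractf sum_distrib_left yc *)
    also have "\<dots> \<in> J"
      using y J(2) by (intro left_ideal_sum[OF J(1)] left_idealD(3)[OF J(1)]) blast
    finally have "uea_const (c i * ?q i) * Uf ^ i \<in> J"
      using left_ideal_cong[OF J(1)] left_idealD(3)[OF J(1) sum, of y] by blast
    moreover have "c i * ?q i \<noteq> 0"
    proof -
      have "of_nat j \<noteq> (of_nat i :: 'a)" if "j < ?p" "j \<noteq> i" for j
        using of_nat_inject_char[of j i] that i by blast
      moreover have "(2 :: 'a) \<noteq> 0"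
        using of_nat_nonzero[of 2] char by simp
      ultimately show ?thesis
        using False by simp
    qed
    ultimately have "Uf ^ i \<in> J"
      by (rule left_ideal_const_cancel[OF J(1)])
    then have "1 \<in> J"
      using False by (intro one_mem_if_f_power_mem[OF J(1,2)]) auto
    with J show ?thesis
      using left_ideal_eq_UNIV by blast
  qed
  then have "(\<Sum>i<?p. uea_const (c i) * Uf ^ i) \<in> annihilator"
    by (intro left_ideal_sum[OF left_ideal_annihilator]) simp
  then show "u \<in> annihilator"
    using left_ideal_cong[OF left_ideal_annihilator] c verma_ideal_le_annihilator by blast
qed

lemma simple_ideal_eq_annihilator: "simple_ideal chi lam = annihilator"
proof
  show "simple_ideal chi lam \<subseteq> annihilator"
    unfolding simple_ideal_def
    using verma_ideal_le_annihilator proper_ideal_le_annihilator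
    by (intro hull_minimal left_ideal_annihilator) blast
  show "annihilator \<subseteq> simple_ideal chi lam"
    using annihilator_proper
    by (intro proper_ideal_le_simple_ideal left_ideal_annihilator verma_ideal_le_annihilator) blast
qed

text \<open>The class of u is sent to u v_0. By \<open>coset_annihilator_eq_iff\<close> the chosen
  representative does not matter and the map is injective, so identities between cosets become
  identities between functions.\<close>

definition coords :: "'a uea set \<Rightarrow> nat \<Rightarrow> 'a" where
  "coords A = uea_act (SOME u. A = coset annihilator u) (\<delta> 0)"

abbreviation "M \<equiv> L chi lam"

lemma coset_annihilator_eq_iff:
  "coset annihilator u = coset annihilator w \<longleftrightarrow> uea_act u (\<delta> 0) = uea_act w (\<delta> 0)"
  unfolding coset_eq_iff[OF left_ideal_annihilator]
  by (simp add: annihilator_def uea_act_simps)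

lemma coords_coset: "coords (coset annihilator u) = uea_act u (\<delta> 0)"
proof -
  have "coset annihilator u = coset annihilator (SOME w. coset annihilator u = coset annihilator w)"
    by (rule someI) simp
  then show ?thesis
    by (simp add: coords_def coset_annihilator_eq_iff)
qed

lemma L_eq: "M = quotient_module annihilator"
  by (simp add: L_def simple_ideal_eq_annihilator)

lemma carrier_eq: "mcarrier M = range (coset annihilator)"
  by (simp add: L_eq quotient_module_def)

lemma coords_unary:
  assumes "A \<in> mcarrier M"
  shows "coords (mscale M c A) = scl c (coords A)" "coords (mact M x A) = rho x (coords A)"
    "mscale M c A \<in> mcarrier M" "mact M x A \<in> mcarrier M" "coords A \<in> W"
proof -
  obtain u where A: "A = coset annihilator u"
    using assms unfolding carrier_eq by blast
  show "coords (mscale M c A) = scl c (coords A)" "coords (mact M x A) = rho x (coords A)"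
    "mscale M c A \<in> mcarrier M" "mact M x A \<in> mcarrier M"
    unfolding carrier_eq unfolding A L_eq quotient_module_simps[OF left_ideal_annihilator]
    by (simp_all add: coords_coset uea_act_simps)
  show "coords A \<in> W"
    unfolding A coords_coset by (rule uea_act_W) (simp add: \<delta>_W)
qed

lemma coords_binary:
  assumes "A \<in> mcarrier M" "B \<in> mcarrier M"
  shows "coords (madd M A B) = coords A + coords B" "coords (mdiff M A B) = coords A - coords B"
    "madd M A B \<in> mcarrier M" "mdiff M A B \<in> mcarrier M"
    and coords_eq_iff: "coords A = coords B \<longleftrightarrow> A = B"
proof -
  obtain u w where A: "A = coset annihilator u" and B: "B = coset annihilator w"
    using assms unfolding carrier_eq by blast
  show "coords (madd M A B) = coords A + coords B" "coords (mdiff M A B) = coords A - coords B"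
    "madd M A B \<in> mcarrier M" "mdiff M A B \<in> mcarrier M"
    unfolding carrier_eq unfolding A B L_eq quotient_module_simps[OF left_ideal_annihilator]
    by (simp_all add: coords_coset uea_act_simps)
  show "coords A = coords B \<longleftrightarrow> A = B"
    by (simp add: A B coords_coset coset_annihilator_eq_iff)
qed

lemmas coords_simps = coords_unary coords_binary

lemma coords_surj:
  assumes "w \<in> W"
  shows "\<exists>A\<in>mcarrier M. coords A = w"
proof -
  have sum: "uea_act (sum g I) v = (\<lambda>i. \<Sum>k\<in>I. uea_act (g k) v i)" for g v and I :: "nat set"
    by (induction I rule: infinite_finite_induct) (auto simp: uea_act_simps fun_eq_iff)
  have "uea_act (\<Sum>k\<le>n. uea_const (w k) * Uf ^ k) (\<delta> 0) i = (\<Sum>k\<le>n. if k = i then w i else 0)" for i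
    unfolding sum by (rule sum.cong) (auto simp: uea_act_simps uea_act_f_power scl_def \<delta>_def)
  then have "uea_act (\<Sum>k\<le>n. uea_const (w k) * Uf ^ k) (\<delta> 0) = w"
    using assms by (auto simp: fun_eq_iff W_def)
  then show ?thesis
    by (auto simp: carrier_eq coords_coset)
qed

lemma coords_zero: "coords (mzero M) = 0"
  by (simp add: L_eq quotient_module_def coords_coset uea_act_simps)

lemma coords_L_vec: "i \<le> n \<Longrightarrow> coords (L_vec chi lam i) = \<delta> i"
  by (simp add: L_vec_def simple_ideal_eq_annihilator coords_coset uea_act_f_power)

end

section \<open>Derivations\<close>

context simple_sl2_string
begin

text \<open>The equations are the derivation rule on [h, e] = 2 e, [h, f] = -2 f and [e, f] =
  h.\<close>

definition cocycle :: "(nat \<Rightarrow> 'a) \<Rightarrow> (nat \<Rightarrow> 'a) \<Rightarrow> (nat \<Rightarrow> 'a) \<Rightarrow> bool" where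
  "cocycle a b c \<longleftrightarrow> a \<in> W \<and> b \<in> W \<and> c \<in> W \<and>
     opH b - opE a = scl 2 b \<and> opH c - opF a = scl (- 2) c \<and> opE c - opF b = a"

lemma op_diff:
  "opE (v - w) = opE v - opE w" "opH (v - w) = opH v - opH w" "opF (v - w) = opF v - opF w"
  by (auto simp: fun_eq_iff opE_def opH_def opF_def algebra_simps)

lemma op_zero: "opE 0 = 0" "opH 0 = 0" "opF 0 = 0"
  by (auto simp: fun_eq_iff opE_def opH_def opF_def)

lemma W_diff: "v \<in> W \<Longrightarrow> w \<in> W \<Longrightarrow> v - w \<in> W"
  by (simp add: W_def)

lemma cocycle_inner: "w \<in> W \<Longrightarrow> cocycle (opH w) (opE w) (opF w)"
  by (simp add: cocycle_def W_closed op_relations)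

lemma cocycle_diff:
  assumes "cocycle a b c" "cocycle a' b' c'"
  shows "cocycle (a - a') (b - b') (c - c')"
proof -
  have "opH (b - b') - opE (a - a') = (opH b - opE a) - (opH b' - opE a')"
    "opH (c - c') - opF (a - a') = (opH c - opF a) - (opH c' - opF a')"
    "opE (c - c') - opF (b - b') = (opE c - opF b) - (opE c' - opF b')"
    by (simp_all add: op_diff)
  with assms show ?thesis
    unfolding cocycle_def by (simp only: scl_simps W_diff)
qed

lemma cocycle_add:
  assumes "cocycle a b c" "cocycle a' b' c'"
  shows "cocycle (a + a') (b + b') (c + c')"
proof -
  have "opH (b + b') - opE (a + a') = (opH b - opE a) + (opH b' - opE a')"
    "opH (c + c') - opF (a + a') = (opH c - opF a) + (opH c' - opF a')"
    "opE (c + c') - opF (b + b') = (opE c - opF b) + (opE c' - opF b')"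
    by (simp_all add: op_linear)
  with assms show ?thesis
    unfolding cocycle_def by (simp only: scl_simps W_closed)
qed

lemma cocycle_inner_if_F_injective:
  assumes "kap \<noteq> 0" and c: "cocycle a b c"
  shows "\<exists>w\<in>W. a = opH w \<and> b = opE w \<and> c = opF w"
proof -
  \<comment> \<open>This is the preimage of \<open>c\<close> under \<open>opF\<close>: undo the
    shift, and divide by \<open>kap\<close> at the index where it wraps around.\<close>
  define w where "w i = (if i < n then c (i + 1) else if i = n then c 0 / kap else 0)" for i
  have w: "w \<in> W" by (simp add: w_def W_def)
  have inj: "v = 0" if "v \<in> W" "opF v = 0" for v
  proof
    fix i
    show "v i = 0 i"
      using fun_cong[OF that(2), of "Suc i"] fun_cong[OF that(2), of 0] that(1) assms(1)
      by (cases "i < n"; cases "i = n") (auto simp: opF_def W_def)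
  qed
  have cw: "c = opF w"
    using c assms(1) by (auto simp: fun_eq_iff opF_def w_def cocycle_def W_def)
  have cc: "cocycle (a - opH w) (b - opE w) 0"
    using cocycle_diff[OF c cocycle_inner[OF w]] by (simp add: cw)
  \<comment> \<open>With value 0 at f, the [h, f] equation puts the value at h into the kernel of f;
    once that vanishes, the [e, f] equation does the same for the value at e.\<close>
  then have "opF (a - opH w) = 0"
    by (simp add: cocycle_def op_zero scl_simps)
  then have a: "a - opH w = 0"
    using cc inj[of "a - opH w"] unfolding cocycle_def by blast
  then have "opF (b - opE w) = 0"
    using cc by (simp add: cocycle_def op_zero)
  then have "b - opE w = 0"
    using cc inj[of "b - opE w"] unfolding cocycle_def by blast
  with a cw w show ?thesis by auto
qed

text \<open>\<open>opH\<close> is diagonal with entries outside the prime field, so it can be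
  inverted to remove \<open>a\<close>. The remaining values at e and f would be eigenvectors for 2
  and -2, which are not weights.\<close>

lemma cocycle_inner_if_H_injective:
  assumes "chi sl2_h \<noteq> 0" and c: "cocycle a b c"
  shows "\<exists>w\<in>W. a = opH w \<and> b = opE w \<and> c = opF w"
proof -
  have nz: "lam - 2 * of_nat i \<noteq> of_int k" for i k
    using lam_not_int[OF assms(1), of "k + 2 * int i"] by (auto simp: algebra_simps)
  have nz0: "lam - 2 * of_nat i \<noteq> 0" for i
    using nz[of i 0] by simp
  define w where "w i = (if i \<le> n then a i / (lam - 2 * of_nat i) else 0)" for i
  have w: "w \<in> W" by (simp add: w_def W_def)
  have aw: "a = opH w"
    using c nz0 by (auto simp: fun_eq_iff opH_def w_def cocycle_def W_def)
  have inj: "v = 0" if "v \<in> W" "opH v = scl (of_int k) v" for v k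
  proof
    fix i
    have "(lam - 2 * of_nat i - of_int k) * v i = 0"
      using fun_cong[OF that(2), of i] that(1)
      by (cases "i \<le> n") (auto simp: opH_def W_def scl_def algebra_simps)
    then show "v i = 0 i"
      using nz[of i k] by simp
  qed
  have cc: "cocycle 0 (b - opE w) (c - opF w)"
    using cocycle_diff[OF c cocycle_inner[OF w]] by (simp add: aw)
  have "b - opE w = 0"
    by (rule inj[of _ 2]) (use cc in \<open>simp_all add: cocycle_def op_zero\<close>)
  moreover have "c - opF w = 0"
    by (rule inj[of _ "- 2"]) (use cc in \<open>simp_all add: cocycle_def op_zero\<close>)
  ultimately show ?thesis
    using aw w by auto
qed

lemma cocycle_restricted:
  assumes "kap = 0" "lam = of_nat n" and c: "cocycle a b c"
  shows "\<exists>w\<in>W. \<exists>\<beta> \<gamma>. a = opH w \<and> b = opE w + scl \<beta> (\<delta> n) \<and> c = opF w + scl \<gamma> (\<delta> 0) \<and>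
    of_nat (n + 2) * \<beta> = 0 \<and> of_nat (n + 2) * \<gamma> = 0"
proof -
  have F: "opF v i = (if i \<le> n \<and> 0 < i then v (i - 1) else 0)" for v i
    unfolding opF_def using assms(1) by simp
  have H: "opH v i = (if i \<le> n then (of_nat n - 2 * of_nat i) * v i else 0)" for v i
    unfolding opH_def using assms(2) by simp
  have ker: "v = scl (v n) (\<delta> n)" if "v \<in> W" "opF v = 0" for v
  proof
    fix i
    show "v i = scl (v n) (\<delta> n) i"
      using fun_cong[OF that(2), of "Suc i"] that(1)
      by (cases "i < n"; cases "i = n") (auto simp: F W_def scl_def \<delta>_def)
  qed
  \<comment> \<open>The image of f consists of the vectors without a v_0 component, so subtracting f
    u leaves only that component of \<open>c\<close>.\<close>
  define u where "u i = (if i < n then c (i + 1) else 0)" for i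
  define \<gamma> where "\<gamma> = c 0"
  have u: "u \<in> W" by (simp add: u_def W_def)
  have cW: "c \<in> W" using c by (simp add: cocycle_def)
  have cu: "c - opF u = scl \<gamma> (\<delta> 0)"
    using cW by (auto simp: fun_eq_iff F u_def W_def scl_def \<delta>_def \<gamma>_def)
  have c1: "cocycle (a - opH u) (b - opE u) (scl \<gamma> (\<delta> 0))"
    using cocycle_diff[OF c cocycle_inner[OF u]] by (simp only: cu)
  have "opH (scl \<gamma> (\<delta> 0)) = scl (of_nat n * \<gamma>) (\<delta> 0)"
    by (auto simp: fun_eq_iff H scl_def \<delta>_def)
  then have "scl (of_nat n * \<gamma>) (\<delta> 0) - opF (a - opH u) = scl (- 2) (scl \<gamma> (\<delta> 0))"
    using c1 by (simp only: cocycle_def)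
  then have "opF (a - opH u) = scl (of_nat n * \<gamma>) (\<delta> 0) - scl (- 2) (scl \<gamma> (\<delta> 0))"
    by (metis add_diff_cancel_left' diff_add_cancel)
  also have "\<dots> = scl (of_nat (n + 2) * \<gamma>) (\<delta> 0)"
    by (simp add: scl_simps algebra_simps)
  finally have Fa: "opF (a - opH u) = scl (of_nat (n + 2) * \<gamma>) (\<delta> 0)" .
  \<comment> \<open>An image under f has no v_0 component, while \<open>Fa\<close> makes this one a
    multiple of v_0. So it is 0, and the value at h lies in the kernel of f, the line of
    v_n.\<close>
  have "opF (a - opH u) 0 = 0"
    by (simp add: F)
  then have \<gamma>: "of_nat (n + 2) * \<gamma> = 0"
    unfolding Fa by (simp add: scl_def \<delta>_def)
  define \<alpha> where "\<alpha> = (a - opH u) n"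
  have a1: "a - opH u = scl \<alpha> (\<delta> n)"
    unfolding \<alpha>_def
  proof (rule ker)
    show "a - opH u \<in> W" using c1 unfolding cocycle_def by blast
    show "opF (a - opH u) = 0" unfolding Fa \<gamma> by (rule scl_simps)
  qed
  \<comment> \<open>For n = 0 the vector v_n has weight 0 and h cannot absorb the multiple of it.
    But then e and f act as zero, and the [e, f] equation gives the claim.\<close>
  have \<alpha>: "\<alpha> = 0" if "n = 0"
  proof -
    have "opE (scl \<gamma> (\<delta> 0)) - opF (b - opE u) = a - opH u"
      using c1 by (simp only: cocycle_def)
    then have "(a - opH u) n = opE (scl \<gamma> (\<delta> 0)) n - opF (b - opE u) n"
      by (metis fun_diff_def)
    then show ?thesis
      unfolding \<alpha>_def opE_def F using that by simp
  qed
  \<comment> \<open>Since h v_n = -n v_n and f v_n = 0, this correction removes the rest of the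
    value at h and leaves the value at f unchanged. For n = 0 the quotient is 0 by convention, which
    agrees with \<open>\<alpha> = 0\<close>.\<close>
  define w where "w = u + scl (- \<alpha> / of_nat n) (\<delta> n)"
  have w: "w \<in> W"
    unfolding w_def by (intro W_closed u \<delta>_W order_refl)
  have Hn: "opH (\<delta> n) = scl (- of_nat n) (\<delta> n)" and Fn: "opF (\<delta> n) = 0"
    by (auto simp: fun_eq_iff H F scl_def \<delta>_def algebra_simps)
  have "- \<alpha> / of_nat n * - of_nat n = \<alpha>"
    using \<alpha> of_nat_nonzero[of n] n_less by (cases "n = 0") auto
  then have "opH w = opH u + scl \<alpha> (\<delta> n)"
    by (simp only: w_def op_linear Hn scl_simps(5))
  then have aw: "a = opH w"
    using a1 by (metis add.commute diff_add_cancel)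
  have Fw: "opF w = opF u"
    by (simp only: w_def op_linear Fn scl_simps add_0_right)
  have c2: "cocycle 0 (b - opE w) (scl \<gamma> (\<delta> 0))"
    using cocycle_diff[OF c cocycle_inner[OF w]] by (simp only: aw[symmetric] Fw cu diff_self)
  define \<beta> where "\<beta> = (b - opE w) n"
  have E0: "opE (scl \<gamma> (\<delta> 0)) = 0"
    by (auto simp: fun_eq_iff opE_def scl_def \<delta>_def)
  have bw: "b - opE w = scl \<beta> (\<delta> n)"
    unfolding \<beta>_def
  proof (rule ker)
    show "b - opE w \<in> W" using c2 unfolding cocycle_def by blast
    have "opE (scl \<gamma> (\<delta> 0)) - opF (b - opE w) = 0" using c2 unfolding cocycle_def by blast
    then show "opF (b - opE w) = 0" unfolding E0 by simp
  qed
  have "opH (scl \<beta> (\<delta> n)) - opE 0 = scl 2 (scl \<beta> (\<delta> n))"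
    using c2 unfolding bw cocycle_def by blast
  then have "opH (scl \<beta> (\<delta> n)) n = scl 2 (scl \<beta> (\<delta> n)) n"
    by (simp only: op_zero diff_zero)
  then have "- (\<beta> * of_nat n) = \<beta> * 2"
    by (simp add: H scl_def \<delta>_def algebra_simps)
  then have "of_nat (n + 2) * \<beta> = \<beta> * of_nat n + - (\<beta> * of_nat n)"
    by (simp add: algebra_simps)
  then have "of_nat (n + 2) * \<beta> = 0"
    by simp
  moreover have "b = opE w + scl \<beta> (\<delta> n)"
    using bw by (metis add.commute diff_add_cancel)
  moreover have "c = opF w + scl \<gamma> (\<delta> 0)"
    unfolding Fw using cu by (metis add.commute diff_add_cancel)
  ultimately show ?thesis
    using w aw \<gamma> by blast
qed

text \<open>With n = -2 in the field, v_n has weight 2 and v_0 has weight -2, the weights of e and f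
  under the adjoint action. Since also f v_n = 0 and e v_0 = 0, each equation holds.\<close>

lemma cocycle_exceptional:
  assumes "kap = 0" "lam = of_nat n" "of_nat (n + 2) = (0 :: 'a)"
  shows "cocycle 0 (scl \<beta> (\<delta> n)) (scl \<gamma> (\<delta> 0))"
proof -
  have "lam = - 2"
    using assms(2,3) by (simp add: eq_neg_iff_add_eq_0 add.commute)
  then have H: "opH v i = (if i \<le> n then (- 2 - 2 * of_nat i) * v i else 0)" for v i
    unfolding opH_def by simp
  have n2: "of_nat n = (- 2 :: 'a)"
    using assms(3) by (simp add: eq_neg_iff_add_eq_0 add.commute)
  have F: "opF v i = (if i \<le> n \<and> 0 < i then v (i - 1) else 0)" for v i
    unfolding opF_def using assms(1) by simp
  have "opF (scl \<beta> (\<delta> n)) = 0" "opE (scl \<gamma> (\<delta> 0)) = 0"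
    "opH (scl \<beta> (\<delta> n)) = scl 2 (scl \<beta> (\<delta> n))" "opH (scl \<gamma> (\<delta> 0)) = scl (- 2) (scl \<gamma> (\<delta> 0))"
    by (auto simp: fun_eq_iff F H opE_def scl_def \<delta>_def n2)
  moreover have "(0 :: nat \<Rightarrow> 'a) \<in> W"
    by (simp add: W_def)
  ultimately show ?thesis
    by (simp only: cocycle_def op_zero W_closed \<delta>_W diff_zero diff_self order_refl le0 simp_thms)
qed

section \<open>Passage between derivations and cocycles\<close>

lemma linear_into_expand:
  assumes "linear_into M \<phi>"
  shows "coords (\<phi> x) = scl (sl2_matrix x $ 1 $ 1) (coords (\<phi> sl2_h))
     + scl (sl2_matrix x $ 1 $ 2) (coords (\<phi> sl2_e)) + scl (sl2_matrix x $ 2 $ 1) (coords (\<phi> sl2_f))"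
proof -
  have c: "\<phi> y \<in> mcarrier M" for y
    using assms by (simp add: linear_into_def)
  have *: "coords (\<phi> (x + y)) = coords (\<phi> x) + coords (\<phi> y)"
    "coords (\<phi> (sl2_scale s x)) = scl s (coords (\<phi> x))" for x y s
    using assms by (simp_all add: linear_into_def coords_simps c)
  show ?thesis
    by (subst sl2_basis_expansion[of x]) (simp only: *)
qed

text \<open>Both sides of the derivation rule are bilinear and alternating, so the three basis
  brackets decide. The scalars in the computation are the 2 by 2 minors of the coordinates of x and
  y.\<close>

lemma Der_iff_cocycle:
  "\<phi> \<in> Der M \<longleftrightarrow> linear_into M \<phi> \<and> cocycle (coords (\<phi> sl2_h)) (coords (\<phi> sl2_e)) (coords (\<phi> sl2_f))"
proof (cases "linear_into M \<phi>")
  case False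
  then show ?thesis by (simp add: Der_def)
next
  case True
  have c: "\<phi> y \<in> mcarrier M" for y
    using True by (simp add: linear_into_def)
  let ?a = "coords (\<phi> sl2_h)" and ?b = "coords (\<phi> sl2_e)" and ?c = "coords (\<phi> sl2_f)"
  have W: "?a \<in> W" "?b \<in> W" "?c \<in> W"
    by (rule coords_unary(5)[OF c])+
  have ops: "coords (mdiff M (mact M x (\<phi> y)) (mact M y (\<phi> x))) = rho x (coords (\<phi> y)) - rho y (coords (\<phi> x))"
    and mem: "mdiff M (mact M x (\<phi> y)) (mact M y (\<phi> x)) \<in> mcarrier M" for x y
    by (simp_all add: coords_simps c)
  have "\<phi> \<in> Der M \<longleftrightarrow> (\<forall>x y. \<phi> (sl2_bracket x y) = mdiff M (mact M x (\<phi> y)) (mact M y (\<phi> x)))"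
    using True by (simp add: Der_def)
  also have "\<dots> \<longleftrightarrow> (\<forall>x y. coords (\<phi> (sl2_bracket x y)) = rho x (coords (\<phi> y)) - rho y (coords (\<phi> x)))"
    using coords_eq_iff[OF c mem] by (simp add: ops)
  also have "\<dots> \<longleftrightarrow> cocycle ?a ?b ?c"
  proof
    assume *: "\<forall>x y. coords (\<phi> (sl2_bracket x y)) = rho x (coords (\<phi> y)) - rho y (coords (\<phi> x))"
    have scale: "coords (\<phi> (sl2_scale s x)) = scl s (coords (\<phi> x))" for s x
      using True by (simp add: linear_into_def coords_simps c)
    show "cocycle ?a ?b ?c"
      using *[rule_format, of sl2_h sl2_e] *[rule_format, of sl2_h sl2_f] *[rule_format, of sl2_e sl2_f]
      unfolding sl2_bracket_basis scale rho_basis cocycle_def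
      by (intro conjI W) (rule sym, assumption)+
  next
    assume co: "cocycle ?a ?b ?c"
    show "\<forall>x y. coords (\<phi> (sl2_bracket x y)) = rho x (coords (\<phi> y)) - rho y (coords (\<phi> x))"
    proof (intro allI)
      fix x y :: "'a sl2"
      let ?x = "sl2_matrix x" and ?y = "sl2_matrix y"
      have "rho x (coords (\<phi> y)) - rho y (coords (\<phi> x)) =
          scl (?x $ 1 $ 2 * ?y $ 2 $ 1 - ?y $ 1 $ 2 * ?x $ 2 $ 1) (opE ?c - opF ?b)
          + scl (?x $ 1 $ 1 * ?y $ 1 $ 2 - ?y $ 1 $ 1 * ?x $ 1 $ 2) (opH ?b - opE ?a)
          + scl (?x $ 1 $ 1 * ?y $ 2 $ 1 - ?y $ 1 $ 1 * ?x $ 2 $ 1) (opH ?c - opF ?a)"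
        unfolding linear_into_expand[OF True, of x] linear_into_expand[OF True, of y] rho_def
          op_linear scl_simps by (simp add: scl_def fun_eq_iff algebra_simps)
      also have "\<dots> = scl (?x $ 1 $ 2 * ?y $ 2 $ 1 - ?y $ 1 $ 2 * ?x $ 2 $ 1) ?a
          + scl (?x $ 1 $ 1 * ?y $ 1 $ 2 - ?y $ 1 $ 1 * ?x $ 1 $ 2) (scl 2 ?b)
          + scl (?x $ 1 $ 1 * ?y $ 2 $ 1 - ?y $ 1 $ 1 * ?x $ 2 $ 1) (scl (- 2) ?c)"
        using co by (simp only: cocycle_def)
      also have "\<dots> = coords (\<phi> (sl2_bracket x y))"
        unfolding linear_into_expand[OF True, of "sl2_bracket x y"]
        by (simp add: sl2_bracket.rep_eq matrix_matrix_mult_def sum_2 sl2_matrix_22 scl_simps)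
          (simp add: scl_def fun_eq_iff algebra_simps)
      finally show "coords (\<phi> (sl2_bracket x y)) = rho x (coords (\<phi> y)) - rho y (coords (\<phi> x))" ..
    qed
  qed
  finally show ?thesis using True by simp
qed

lemma linear_into_mact: "A \<in> mcarrier M \<Longrightarrow> linear_into M (\<lambda>x. mact M x A)"
  unfolding linear_into_def using coords_eq_iff[of "mact M (x + y) A" "madd M (mact M x A) (mact M y A)" for x y]
    coords_eq_iff[of "mact M (sl2_scale s x) A" "mscale M s (mact M x A)" for s x]
  by (simp add: coords_simps rho_add rho_scale)

lemma Ider_subset_Der: "Ider M \<subseteq> Der M"
  by (auto simp: Ider_def Der_iff_cocycle linear_into_mact coords_simps rho_basis cocycle_inner)

lemma linear_into_eqI:
  assumes "linear_into M \<phi>" "linear_into M \<psi>" "coords (\<phi> sl2_h) = coords (\<psi> sl2_h)"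
    "coords (\<phi> sl2_e) = coords (\<psi> sl2_e)" "coords (\<phi> sl2_f) = coords (\<psi> sl2_f)"
  shows "\<phi> = \<psi>"
proof
  fix x
  have "\<phi> x \<in> mcarrier M" "\<psi> x \<in> mcarrier M"
    using assms(1,2) by (simp_all add: linear_into_def)
  moreover have "coords (\<phi> x) = coords (\<psi> x)"
    unfolding linear_into_expand[OF assms(1), of x] linear_into_expand[OF assms(2), of x]
    using assms(3-5) by simp
  ultimately show "\<phi> x = \<psi> x"
    by (simp add: coords_eq_iff)
qed

lemma Der_eq_Ider:
  assumes "\<And>a b c. cocycle a b c \<Longrightarrow> \<exists>w\<in>W. a = opH w \<and> b = opE w \<and> c = opF w"
  shows "Der M = Ider M"
proof
  show "Ider M \<subseteq> Der M" by (rule Ider_subset_Der)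
  show "Der M \<subseteq> Ider M"
  proof
    fix \<phi> assume "\<phi> \<in> Der M"
    then have lin: "linear_into M \<phi>"
      and "cocycle (coords (\<phi> sl2_h)) (coords (\<phi> sl2_e)) (coords (\<phi> sl2_f))"
      by (simp_all add: Der_iff_cocycle)
    from assms[OF this(2)] obtain w where "w \<in> W" and w: "coords (\<phi> sl2_h) = opH w"
      "coords (\<phi> sl2_e) = opE w" "coords (\<phi> sl2_f) = opF w"
      by blast
    then obtain A where A: "A \<in> mcarrier M" "coords A = w"
      using coords_surj by blast
    have "\<phi> = (\<lambda>x. mact M x A)"
      by (rule linear_into_eqI[OF lin linear_into_mact[OF A(1)]])
        (simp_all add: coords_simps A w rho_basis)
    then show "\<phi> \<in> Ider M"
      using A(1) by (auto simp: Ider_def)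
  qed
qed

lemma linear_into_combination:
  assumes "linear_into M D" "linear_into M d1" "linear_into M d2"
  shows "linear_into M (\<lambda>x. madd M (D x) (madd M (mscale M a (d1 x)) (mscale M b (d2 x))))"
proof -
  have c: "D x \<in> mcarrier M" "d1 x \<in> mcarrier M" "d2 x \<in> mcarrier M" for x
    using assms by (simp_all add: linear_into_def)
  show ?thesis
    unfolding linear_into_def
  proof (intro conjI allI)
    fix x y s
    show "madd M (D x) (madd M (mscale M a (d1 x)) (mscale M b (d2 x))) \<in> mcarrier M"
      by (simp add: coords_simps c)
    show "madd M (D (x + y)) (madd M (mscale M a (d1 (x + y))) (mscale M b (d2 (x + y))))
        = madd M (madd M (D x) (madd M (mscale M a (d1 x)) (mscale M b (d2 x))))
            (madd M (D y) (madd M (mscale M a (d1 y)) (mscale M b (d2 y))))"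
      using assms by (subst coords_eq_iff[symmetric])
        (simp_all add: linear_into_def coords_simps c scl_simps algebra_simps)
    show "madd M (D (sl2_scale s x)) (madd M (mscale M a (d1 (sl2_scale s x))) (mscale M b (d2 (sl2_scale s x))))
        = mscale M s (madd M (D x) (madd M (mscale M a (d1 x)) (mscale M b (d2 x))))"
      using assms by (subst coords_eq_iff[symmetric])
        (simp_all add: linear_into_def coords_simps c scl_simps mult.commute)
  qed
qed

lemma Der_exceptional:
  assumes "kap = 0" "lam = of_nat n" "of_nat (n + 2) = (0 :: 'a)"
    and d1: "linear_into M d1" "coords (d1 sl2_h) = 0" "coords (d1 sl2_e) = \<delta> n" "coords (d1 sl2_f) = 0"
    and d2: "linear_into M d2" "coords (d2 sl2_h) = 0" "coords (d2 sl2_e) = 0" "coords (d2 sl2_f) = \<delta> 0"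
  shows "Der M = {\<lambda>x. madd M (D x) (madd M (mscale M a (d1 x)) (mscale M b (d2 x))) | D a b. D \<in> Ider M}"
    (is "_ = ?R")
proof -
  have car: "d1 x \<in> mcarrier M" "d2 x \<in> mcarrier M" for x
    using d1(1) d2(1) by (simp_all add: linear_into_def)
  show ?thesis
  proof
    show "Der M \<subseteq> ?R"
    proof
      fix \<phi> assume "\<phi> \<in> Der M"
      then have lin: "linear_into M \<phi>"
        and "cocycle (coords (\<phi> sl2_h)) (coords (\<phi> sl2_e)) (coords (\<phi> sl2_f))"
        by (simp_all add: Der_iff_cocycle)
      from cocycle_restricted[OF assms(1,2) this(2)] obtain w \<beta> \<gamma> where "w \<in> W" and w:
        "coords (\<phi> sl2_h) = opH w" "coords (\<phi> sl2_e) = opE w + scl \<beta> (\<delta> n)"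
        "coords (\<phi> sl2_f) = opF w + scl \<gamma> (\<delta> 0)"
        by blast
      then obtain A where A: "A \<in> mcarrier M" "coords A = w"
        using coords_surj by blast
      have "\<phi> = (\<lambda>x. madd M (mact M x A) (madd M (mscale M \<beta> (d1 x)) (mscale M \<gamma> (d2 x))))"
        by (rule linear_into_eqI[OF lin linear_into_combination[OF linear_into_mact[OF A(1)] d1(1) d2(1)]])
          (simp_all add: coords_simps A car w rho_basis d1 d2 scl_simps)
      moreover have "(\<lambda>x. mact M x A) \<in> Ider M"
        using A(1) unfolding Ider_def by blast
      ultimately show "\<phi> \<in> ?R"
        unfolding mem_Collect_eq by (intro exI conjI)
    qed
    show "?R \<subseteq> Der M"
    proof
      fix \<phi> assume "\<phi> \<in> ?R"
      then obtain A a b where A: "A \<in> mcarrier M"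
        and \<phi>: "\<phi> = (\<lambda>x. madd M (mact M x A) (madd M (mscale M a (d1 x)) (mscale M b (d2 x))))"
        unfolding Ider_def by blast
      have "linear_into M \<phi>"
        unfolding \<phi> by (rule linear_into_combination[OF linear_into_mact[OF A] d1(1) d2(1)])
      moreover have "cocycle (coords (\<phi> sl2_h)) (coords (\<phi> sl2_e)) (coords (\<phi> sl2_f))"
        using cocycle_add[OF cocycle_inner[of "coords A"] cocycle_exceptional[OF assms(1-3), of a b]]
        by (simp add: \<phi> coords_simps A car rho_basis d1 d2 scl_simps)
      ultimately show "\<phi> \<in> Der M"
        by (simp add: Der_iff_cocycle)
    qed
  qed
qed

end

theorem theorem3p1:
  fixes chi :: "'a::field sl2 \<Rightarrow> 'a" and lam :: 'a and p :: nat
    and d1 d2 :: "'a sl2 \<Rightarrow> 'a uea set"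
  assumes "CHAR('a) = p" and "p > 2"
    and "Vector_Spaces.linear sl2_scale (*) chi"
    and "chi sl2_e = 0"
    and "lam \<in> Lambda chi"
    and "linear_into (L (\<lambda>_. 0) (of_nat (p - 2))) d1"
    and "d1 sl2_h = mzero (L (\<lambda>_. 0) (of_nat (p - 2)))"
    and "d1 sl2_f = mzero (L (\<lambda>_. 0) (of_nat (p - 2)))"
    and "d1 sl2_e = L_vec (\<lambda>_. 0) (of_nat (p - 2)) (p - 2)"
    and "linear_into (L (\<lambda>_. 0) (of_nat (p - 2))) d2"
    and "d2 sl2_h = mzero (L (\<lambda>_. 0) (of_nat (p - 2)))"
    and "d2 sl2_e = mzero (L (\<lambda>_. 0) (of_nat (p - 2)))"
    and "d2 sl2_f = L_vec (\<lambda>_. 0) (of_nat (p - 2)) 0"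
  shows "Der (L chi lam) =
    (if chi = (\<lambda>_. 0) \<and> lam = of_nat (p - 2)
     then {\<lambda>x. madd (L chi lam) (D x)
                  (madd (L chi lam) (mscale (L chi lam) a (d1 x)) (mscale (L chi lam) b (d2 x)))
           | D a b. D \<in> Ider (L chi lam)}
     else Ider (L chi lam))"
proof (cases "chi = (\<lambda>_. 0)")
  case True
  have "lam ^ p = lam"
    using assms(1,2,5) True by (simp add: Lambda_def zero_power)
  \<comment> \<open>This \<open>n\<close> is Phi(lam); the locale condition \<open>top\<close> holds
    because its factor \<open>lam - of_nat n\<close> is 0.\<close>
  then obtain n where n: "lam = of_nat n" "n < p"
    using frobenius_fixed_imp_of_nat[of lam] assms(1,2) by auto
  have "sl2_string chi lam 0 n"
    by (intro sl2_string.intro) (use assms True n in \<open>simp_all add: zero_power\<close>)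
  then interpret simple_sl2_string chi lam 0 n
  proof (intro simple_sl2_string.intro simple_sl2_string_axioms.intro)
    show "(0::'a) \<noteq> 0 \<or> (\<forall>i>0. i \<le> n \<longrightarrow> lam - of_nat i + 1 \<noteq> 0)"
    proof (intro disjI2 allI impI)
      fix i assume i: "0 < i" "i \<le> n"
      then have "lam - of_nat i + 1 = of_nat (n - i + 1)"
        by (simp add: n of_nat_diff)
      moreover have "\<not> p dvd n - i + 1"
        using i n(2) by (auto dest: dvd_imp_le)
      then have "of_nat (n - i + 1) \<noteq> (0 :: 'a)"
        unfolding of_nat_eq_0_iff_char_dvd assms(1) .
      ultimately show "lam - of_nat i + 1 \<noteq> 0"
        by (simp only: not_False_eq_True)
    qed
  qed
  show ?thesis
  proof (cases "n = p - 2")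
    case n_eq: True
    have "n + 2 = CHAR('a)"
      using n_eq assms(1,2) by simp
    then have n2: "of_nat (n + 2) = (0 :: 'a)"
      by (simp only: of_nat_CHAR)
    have L: "L (\<lambda>_. 0) (of_nat (p - 2)) = M" "L_vec (\<lambda>_. 0) (of_nat (p - 2)) = L_vec chi lam"
      using True n(1) n_eq by simp_all
    have "chi = (\<lambda>_. 0) \<and> lam = of_nat (p - 2)"
      using True n n_eq by simp
    moreover have "Der M = {\<lambda>x. madd M (D x) (madd M (mscale M a (d1 x)) (mscale M b (d2 x)))
        | D a b. D \<in> Ider M}"
      using assms(6-13)[unfolded L] n_eq[symmetric]
      by (intro Der_exceptional[OF refl n(1) n2]) (simp_all only: coords_zero coords_L_vec order_refl le0)
    ultimately show ?thesis by (simp only: if_True simp_thms)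
  next
    case False
    \<comment> \<open>Since n < p, the number n + 2 lies strictly between 0 and 2 p, so p divides it
      only when n = p - 2.\<close>
    have n2: "of_nat (n + 2) \<noteq> (0 :: 'a)"
    proof
      assume "of_nat (n + 2) = (0 :: 'a)"
      then obtain k where k: "n + 2 = p * k"
        unfolding of_nat_eq_0_iff_char_dvd assms(1) by (elim dvdE)
      moreover have "p * 2 > n + 2"
        using n(2) assms(2) by simp
      ultimately have "k < 2"
        by (metis mult_less_cancel1)
      then show False
        using k False by (auto simp: less_2_cases_iff)
    qed
    have "Der M = Ider M"
    proof (rule Der_eq_Ider)
      fix a b c assume "cocycle a b c"
      from cocycle_restricted[OF refl n(1) this] show "\<exists>w\<in>W. a = opH w \<and> b = opE w \<and> c = opF w"
        using n2 by (auto simp: scl_simps simp del: of_nat_add)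
    qed
    moreover have "lam \<noteq> of_nat (p - 2)"
    proof
      assume "lam = of_nat (p - 2)"
      then have "of_nat (n + 2) = (of_nat (p - 2 + 2) :: 'a)"
        using n(1) by simp
      also have "\<dots> = 0"
        using assms(1,2) of_nat_CHAR[where 'a = 'a] by simp
      finally show False using n2 by contradiction
    qed
    ultimately show ?thesis by simp
  qed
next
  case False
  interpret chi: Vector_Spaces.linear sl2_scale "(*)" chi by (rule assms(3))
  have nz: "chi sl2_h \<noteq> 0 \<or> chi sl2_f \<noteq> 0"
  proof (rule ccontr)
    assume "\<not> (chi sl2_h \<noteq> 0 \<or> chi sl2_f \<noteq> 0)"
    then have "chi x = 0" for x
      by (subst sl2_basis_expansion[of x]) (simp add: chi.add chi.scale assms(4))
    with False show False by blast
  qed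
  let ?kap = "chi sl2_f ^ CHAR('a)"
  \<comment> \<open>The string now has full length p, and \<open>top\<close> holds because its other
    factor, n + 1 = p, is 0 in the field.\<close>
  have "p - 1 + 1 = CHAR('a)"
    using assms(1,2) by simp
  then have "of_nat (p - 1 + 1) = (0 :: 'a)"
    by (simp only: of_nat_CHAR)
  then have "sl2_string chi lam ?kap (p - 1)"
    using assms(1-5) by (intro sl2_string.intro) simp_all
  then interpret sl2_string chi lam ?kap "p - 1" .
  interpret simple_sl2_string chi lam ?kap "p - 1"
  proof (intro simple_sl2_string.intro simple_sl2_string_axioms.intro sl2_string_axioms)
    show "?kap \<noteq> 0 \<or> (\<forall>i>0. i \<le> p - 1 \<longrightarrow> lam - of_nat i + 1 \<noteq> 0)"
    proof (cases "chi sl2_f = 0")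
      case True
      have "lam \<noteq> of_int k" for k
        using nz True lam_not_int by blast
      then have "lam \<noteq> of_int (int i - 1)" for i .
      then have "lam - of_nat i + 1 \<noteq> 0" for i
        by (simp add: algebra_simps)
      then show ?thesis by blast
    qed simp
  qed
  have "Der M = Ider M"
  proof (rule Der_eq_Ider)
    fix a b c assume co: "cocycle a b c"
    have "chi sl2_h \<noteq> 0 \<or> ?kap \<noteq> 0"
      using nz by auto
    then show "\<exists>w\<in>W. a = opH w \<and> b = opE w \<and> c = opF w"
      using cocycle_inner_if_H_injective[OF _ co] cocycle_inner_if_F_injective[OF _ co] by blast
  qed
  then show ?thesis using False by simp
qed

end
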